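(* Let $X$ and $Y$ be Banach spaces having no subspace isomorphic to $c_0$, and let $K$ and $L$ be compact Hausdorff spaces such that $C(K)$ is isomorphic to $c_0(C(K))$ and $C(L)$ is isomorphic to $c_0(C(L))$. If $\ell_\infty(C(K,X))$ is isomorphic to $\ell_\infty(C(L,Y))$, then $|K|=|L|$; moreover, in this case, $L$ is scattered if and only if $K$ is scattered.
   Context: For a compact Hausdorff space $K$ and a Banach space $X$, $C(K,X)$ is the Banach space of all continuous functions $f:K\to X$ with the supremum norm, and $C(K)=C(K,\mathbb{R})$. For a Banach space $Z$, $\ell_\infty(Z)$ is the Banach space of bounded sequences in $Z$ and $c_0(Z)$ is the Banach space of sequences in $Z$ converging to $0$ in norm, both with the supremum norm; $c_0=c_0(\mathbb{R})$. $|K|$ denotes the cardinality of $K$. Isomorphic means linearly homeomorphic. A topological space is scattered if every non-empty subset has a relatively isolated point.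
   Formalization: X and Y are assumed nonzero (for X = Y = {0} the claim fails, e.g. K = [0,ω], L = [0,1]), and K and L are nonempty (for nonzero X, Y the empty case is trivial). *)

theory Defs
  imports "HOL-Analysis.Analysis" "HOL-Library.Equipollence"
begin

text \<open>
  The spaces of the statement are types or linear subspaces of types:

  \<^item> for a compact Hausdorff space \<open>'k\<close>, the space \<open>C('k, 'x)\<close> is \<open>'k \<Rightarrow>\<^sub>C 'x\<close>, since on a
    compact space every continuous function is bounded;
  \<^item> \<open>\<ell>\<^sub>\<infinity>('z)\<close> is \<open>nat \<Rightarrow>\<^sub>C 'z\<close>, since \<^typ>\<open>nat\<close> carries the discrete topology.

  In both cases the norm of \<open>_ \<Rightarrow>\<^sub>C _\<close> is the supremum norm.
\<close>

definition c0_space :: "(nat \<Rightarrow>\<^sub>C 'z::real_normed_vector) set" where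
  "c0_space = {s. apply_bcontfun s \<longlonglongrightarrow> 0}"

text \<open>Linear homeomorphism between linear subspaces, with their relative norm topologies.\<close>

definition isomorphic_spaces ::
    "'a::real_normed_vector set \<Rightarrow> 'b::real_normed_vector set \<Rightarrow> bool" where
  "isomorphic_spaces S T \<longleftrightarrow>
     subspace S \<and> subspace T \<and>
     (\<exists>f g. homeomorphism S T f g \<and>
        (\<forall>x\<in>S. \<forall>y\<in>S. f (x + y) = f x + f y) \<and>
        (\<forall>c. \<forall>x\<in>S. f (c *\<^sub>R x) = c *\<^sub>R f x))"

text \<open>The subspace \<open>S\<close> is automatically closed, being isomorphic to a complete space.\<close>

definition contains_c0 :: "'x::banach itself \<Rightarrow> bool" where
  "contains_c0 _ \<longleftrightarrow>
     (\<exists>S::'x set. isomorphic_spaces S (c0_space :: (nat \<Rightarrow>\<^sub>C real) set))"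

definition scattered_space :: "'k::topological_space itself \<Rightarrow> bool" where
  "scattered_space _ \<longleftrightarrow>
     (\<forall>A::'k set. A \<noteq> {} \<longrightarrow> (\<exists>x. x isolated_in A))"

lemma subspace_c0_space: "subspace (c0_space :: (nat \<Rightarrow>\<^sub>C 'z::real_normed_vector) set)"
proof (rule subspaceI)
  show "(0 :: nat \<Rightarrow>\<^sub>C 'z) \<in> c0_space"
    by (simp add: c0_space_def zero_bcontfun.rep_eq)
  show "x + y \<in> c0_space" if "x \<in> c0_space" "y \<in> c0_space" for x y :: "nat \<Rightarrow>\<^sub>C 'z"
    using that tendsto_add[of "apply_bcontfun x" 0 sequentially "apply_bcontfun y" 0]
    by (simp add: c0_space_def plus_bcontfun.rep_eq)
  show "c *\<^sub>R x \<in> c0_space" if "x \<in> c0_space" for c and x :: "nat \<Rightarrow>\<^sub>C 'z"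
    using that tendsto_scaleR[OF tendsto_const[of c], of "apply_bcontfun x" 0 sequentially]
    by (simp add: c0_space_def scaleR_bcontfun.rep_eq)
qed

end

theory Submission
  imports Defs
begin

text \<open>
Write \<open>C('k, 'x)\<close> for the space \<open>'k \<Rightarrow>\<^sub>C 'x\<close> and \<open>C('k)\<close> for \<open>'k \<Rightarrow>\<^sub>C real\<close>.  By symmetry it suffices to
prove that the cardinality of \<open>'k\<close> is at most that of \<open>'l\<close>, and that \<open>'k\<close> is scattered if \<open>'l\<close> is.

The passage from \<open>\<ell>\<^sub>\<infinity>\<close> to finitely many coordinates is where the hypothesis on \<open>C('k)\<close> comes in.  The space
\<open>C('k)\<close>, being isomorphic to \<open>c\<^sub>0(C('k))\<close>, is complemented in \<open>C('k, 'x)\<close> and therefore in \<open>\<ell>\<^sub>\<infinity>(C('l, 'y))\<close>.  If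
no summand of a complemented \<open>c\<^sub>0\<close>-sum were embedded by finitely many coordinates of \<open>\<ell>\<^sub>\<infinity>\<close>, a gliding hump
would extend the inclusion of a copy of \<open>c\<^sub>0\<close> to all of \<open>\<ell>\<^sub>\<infinity>\<close>, and composing with the projection would
contradict Phillips' lemma (\<open>complemented_c0_sum_fixes_coordinates\<close>).  So \<open>C('k)\<close> embeds into the continuous
\<open>'y\<close>-valued functions on a compact space \<open>S\<close>, a finite sum of copies of \<open>'l\<close>.

Let \<open>E\<close> be such an embedding.  Each point \<open>p\<close> of \<open>S\<close> gives an operator \<open>\<lambda>v. E v p\<close> from \<open>C('k)\<close> to \<open>'y\<close>.  As \<open>'y\<close> does
not contain \<open>c\<^sub>0\<close>, the Bessaga-Pelczynski theorem shows that it sends disjointly supported bounded sequences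
to null sequences (\<open>no_escaping_bumps\<close>); it behaves like a countably additive measure, and in particular it has
only finitely many atoms of mass at least \<open>d > 0\<close> (\<open>finite_atoms\<close>).  Conversely, Simons' lemma and the compactness
of \<open>S\<close> show that every point of \<open>'k\<close> is an atom of mass at least \<open>d\<close> for some \<open>p\<close>, provided \<open>d\<close> is smaller than
the lower bound of \<open>E\<close> (\<open>atom_exists\<close>).  Thus \<open>'k\<close> is a union of finite sets indexed by \<open>S\<close>;
and \<open>S\<close> is as large as \<open>'l\<close>, which cannot be finite when \<open>C('l)\<close> is isomorphic to \<open>c\<^sub>0(C('l))\<close>
(\<open>infinite_if_isomorphic_c0_sum\<close>).

If \<open>'k\<close> is not scattered, it carries a Cantor scheme of bump functions, and the same two arguments apply to the
branches of the scheme in place of points: each branch is detected by some \<open>p\<close>, and each \<open>p\<close> detects countably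
many branches.  What \<open>p\<close> detects depends only on countably many continuous functions of \<open>p\<close>.  If \<open>'l\<close> is
scattered, these take only countably many joint values (\<open>countable_image_if_scattered\<close>), but
there are uncountably many branches (\<open>scattered_domain\<close>).
\<close>

section \<open>Norming functionals\<close>

definition sublinear :: "('v::real_vector \<Rightarrow> real) \<Rightarrow> bool" where
  "sublinear q \<longleftrightarrow> (\<forall>x y. q (x + y) \<le> q x + q y) \<and> (\<forall>c x. 0 \<le> c \<longrightarrow> q (c *\<^sub>R x) = c * q x)"

lemma sublinear_add: "sublinear q \<Longrightarrow> q (x + y) \<le> q x + q y"
  and sublinear_scale: "sublinear q \<Longrightarrow> 0 \<le> c \<Longrightarrow> q (c *\<^sub>R x) = c * q x"
  by (auto simp: sublinear_def)

lemma sublinear_zero: "sublinear q \<Longrightarrow> q 0 = 0"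
  using sublinear_scale[of q 0 0] by simp

lemma sublinear_minus: "sublinear q \<Longrightarrow> - q (- x) \<le> q x"
  using sublinear_add[of q x "-x"] sublinear_zero[of q] by simp

text \<open>
Moving from \<open>x\<close> along \<open>v\<close> before evaluating \<open>q\<close>, and refunding the price \<open>q v\<close> of each unit of the
move, can only lower the value of a sublinear \<open>q\<close>.  A functional that is not lowered by this in
any direction is superadditive.
\<close>

definition slope_reduct :: "('v::real_vector \<Rightarrow> real) \<Rightarrow> 'v \<Rightarrow> 'v \<Rightarrow> real" where
  "slope_reduct q v x = (INF t\<in>{0..}. q (x + t *\<^sub>R v) - t * q v)"

lemma slope_reduct_bdd:
  assumes "sublinear q"
  shows "bdd_below ((\<lambda>t. q (x + t *\<^sub>R v) - t * q v) ` {0..})"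
proof (rule bdd_belowI2)
  fix t :: real assume "t \<in> {0..}"
  then have "t * q v = q (t *\<^sub>R v)" using sublinear_scale[OF assms] by simp
  also have "\<dots> \<le> q (x + t *\<^sub>R v) + q (- x)"
    using sublinear_add[OF assms, of "x + t *\<^sub>R v" "-x"] by simp
  finally show "- q (- x) \<le> q (x + t *\<^sub>R v) - t * q v" by simp
qed

lemma slope_reduct_le:
  assumes "sublinear q" "0 \<le> t"
  shows "slope_reduct q v x \<le> q (x + t *\<^sub>R v) - t * q v"
  unfolding slope_reduct_def by (rule cINF_lower[OF slope_reduct_bdd[OF assms(1)]]) (use assms in auto)

lemma sublinear_slope_reduct:
  assumes q: "sublinear q"
  shows "sublinear (slope_reduct q v)"
proof -
  let ?r = "slope_reduct q v"
  have ge: "a \<le> ?r x" if "\<And>t. 0 \<le> t \<Longrightarrow> a \<le> q (x + t *\<^sub>R v) - t * q v" for a x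
    unfolding slope_reduct_def by (rule cINF_greatest) (use that in auto)
  have add: "?r (x + y) \<le> ?r x + ?r y" for x y
  proof -
    have "?r (x + y) - (q (y + s *\<^sub>R v) - s * q v) \<le> ?r x" if s: "0 \<le> s" for s
    proof (rule ge)
      fix t :: real assume t: "0 \<le> t"
      have "?r (x + y) \<le> q ((x + y) + (t + s) *\<^sub>R v) - (t + s) * q v"
        using slope_reduct_le[OF q] s t by simp
      also have "(x + y) + (t + s) *\<^sub>R v = (x + t *\<^sub>R v) + (y + s *\<^sub>R v)"
        by (simp add: algebra_simps)
      also have "q \<dots> \<le> q (x + t *\<^sub>R v) + q (y + s *\<^sub>R v)" by (rule sublinear_add[OF q])
      finally show "?r (x + y) - (q (y + s *\<^sub>R v) - s * q v) \<le> q (x + t *\<^sub>R v) - t * q v"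
        by (simp add: algebra_simps)
    qed
    then have "?r (x + y) - ?r x \<le> ?r y"
      by (intro ge) (smt (verit))
    then show ?thesis by simp
  qed
  have le: "?r (c *\<^sub>R x) \<le> c * ?r x" if c: "0 < c" for c x
  proof -
    have "?r (c *\<^sub>R x) / c \<le> ?r x"
    proof (rule ge)
      fix t :: real assume t: "0 \<le> t"
      have "?r (c *\<^sub>R x) \<le> q (c *\<^sub>R x + (c * t) *\<^sub>R v) - (c * t) * q v"
        using slope_reduct_le[OF q] c t by simp
      also have "c *\<^sub>R x + (c * t) *\<^sub>R v = c *\<^sub>R (x + t *\<^sub>R v)" by (simp add: algebra_simps)
      also have "q \<dots> = c * q (x + t *\<^sub>R v)" using sublinear_scale[OF q] c by simp
      finally show "?r (c *\<^sub>R x) / c \<le> q (x + t *\<^sub>R v) - t * q v"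
        using c by (simp add: field_simps)
    qed
    then show ?thesis using c by (simp add: field_simps)
  qed
  have scale: "?r (c *\<^sub>R x) = c * ?r x" if c: "0 \<le> c" for c x
  proof (cases "c = 0")
    case True
    have "0 \<le> ?r 0" by (rule ge) (simp add: sublinear_scale[OF q])
    moreover have "?r 0 \<le> 0" using slope_reduct_le[OF q, of 0 v 0] sublinear_zero[OF q] by simp
    ultimately show ?thesis using True by simp
  next
    case False
    then have c: "0 < c" using c by simp
    have "?r ((1/c) *\<^sub>R (c *\<^sub>R x)) \<le> (1/c) * ?r (c *\<^sub>R x)" using c by (intro le) simp
    then have "c * ?r x \<le> ?r (c *\<^sub>R x)" using c by (simp add: field_simps)
    then show ?thesis using le[OF c, of x] by simp
  qed
  show ?thesis unfolding sublinear_def using add scale by blast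
qed

text \<open>
Comparing a minimal \<open>q\<close> with its reducts gives \<open>q x \<le> q (x + v) - q v\<close>, so \<open>q\<close> is additive.  The
extension of functionals step by step is thereby replaced by a single appeal to Zorn's lemma.
\<close>

lemma minimal_sublinear_linear:
  assumes q: "sublinear q" and min: "\<And>r. sublinear r \<Longrightarrow> (\<And>x. r x \<le> q x) \<Longrightarrow> r = q"
  shows "linear q"
proof -
  have "slope_reduct q v = q" for v
    by (rule min[OF sublinear_slope_reduct[OF q]]) (use slope_reduct_le[OF q, of 0 v] in simp)
  then have "q x \<le> q (x + v) - q v" for x v
    using slope_reduct_le[OF q, of 1 v x] by simp
  then have add: "q (x + v) = q x + q v" for x v
    using sublinear_add[OF q, of x v] by (smt (verit))
  have neg: "q (- x) = - q x" for x using add[of x "-x"] sublinear_zero[OF q] by simp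
  have "q (c *\<^sub>R x) = c *\<^sub>R q x" for c x
  proof (cases "0 \<le> c")
    case True then show ?thesis using sublinear_scale[OF q] by simp
  next
    case False
    then have "q ((- c) *\<^sub>R x) = (- c) * q x" using sublinear_scale[OF q, of "- c" x] by simp
    then show ?thesis using neg[of "c *\<^sub>R x"] by simp
  qed
  then show ?thesis using add by (intro linearI) auto
qed

lemma linear_below_sublinear:
  assumes p: "sublinear p"
  shows "\<exists>f. linear f \<and> (\<forall>x. f x \<le> p x)"
proof -
  define Q where "Q = {q. sublinear q \<and> (\<forall>x. q x \<le> p x)}"
  define R where "R = {(q, r). q \<in> Q \<and> r \<in> Q \<and> (\<forall>x. r x \<le> q x)}"
  have FR: "Field R = Q" unfolding R_def Field_def by auto
  have po: "Partial_order R"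
    unfolding partial_order_on_def preorder_on_def refl_on_def trans_def antisym_def FR
    by (auto simp: R_def fun_eq_iff intro: order_trans order_antisym)
  have "\<exists>q\<in>Field R. \<forall>r\<in>Field R. (q, r) \<in> R \<longrightarrow> r = q"
  proof (rule Zorns_po_lemma[OF po])
    fix C assume C: "C \<in> Chains R"
    then have CQ: "C \<subseteq> Q" and tot: "\<And>q r. q \<in> C \<Longrightarrow> r \<in> C \<Longrightarrow> (\<forall>x. r x \<le> q x) \<or> (\<forall>x. q x \<le> r x)"
      by (auto simp: Chains_def R_def)
    show "\<exists>u\<in>Field R. \<forall>q\<in>C. (q, u) \<in> R"
    proof (cases "C = {}")
      case True then show ?thesis using p by (auto simp: FR Q_def)
    next
      case ne: False
      define u where "u x = (INF q\<in>C. q x)" for x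
      \<comment> \<open>sublinearity turns the common upper bound \<open>p\<close> into a common lower bound, so the infimum is finite\<close>
      have bdd: "bdd_below ((\<lambda>q. q x) ` C)" for x
      proof (rule bdd_belowI2)
        fix q assume "q \<in> C"
        then have "sublinear q" "q (- x) \<le> p (- x)" using CQ by (auto simp: Q_def)
        then show "- p (- x) \<le> q x" using sublinear_minus[of q x] by simp
      qed
      have ule: "u x \<le> q x" if "q \<in> C" for q x
        unfolding u_def by (rule cINF_lower[OF bdd that])
      have uge: "a \<le> u x" if "\<And>q. q \<in> C \<Longrightarrow> a \<le> q x" for a x
        unfolding u_def by (rule cINF_greatest[OF ne]) (use that in auto)
      have sub: "sublinear q" if "q \<in> C" for q using CQ that by (auto simp: Q_def)
      have add: "u (x + y) \<le> u x + u y" for x y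
      proof -
        have "u (x + y) - r y \<le> u x" if r: "r \<in> C" for r
        proof (rule uge)
          fix q assume q: "q \<in> C"
          obtain s where s: "s \<in> C" "\<forall>x. s x \<le> q x" "\<forall>x. s x \<le> r x" using tot[OF q r] q r by blast
          have "u (x + y) \<le> s x + s y" using ule[OF s(1)] sublinear_add[OF sub[OF s(1)]] order_trans by blast
          also have "\<dots> \<le> q x + r y" using s by (simp add: add_mono)
          finally show "u (x + y) - r y \<le> q x" by simp
        qed
        then have "u (x + y) - u x \<le> u y" by (intro uge) (smt (verit))
        then show ?thesis by simp
      qed
      have scale: "u (c *\<^sub>R x) = c * u x" if c: "0 \<le> c" for c x
      proof (cases "c = 0")
        case True
        have "u 0 = 0" using ule[of _ 0] uge[of 0 0] sub sublinear_zero ne by (metis antisym ex_in_conv order_refl)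
        then show ?thesis using True by simp
      next
        case False
        then have c: "0 < c" using c by simp
        have "u (c *\<^sub>R x) / c \<le> u x"
        proof (rule uge)
          fix q assume q: "q \<in> C"
          show "u (c *\<^sub>R x) / c \<le> q x"
            using ule[OF q, of "c *\<^sub>R x"] sublinear_scale[OF sub[OF q], of c x] c by (simp add: field_simps)
        qed
        moreover have "c * u x \<le> u (c *\<^sub>R x)"
        proof (rule uge)
          fix q assume q: "q \<in> C"
          show "c * u x \<le> q (c *\<^sub>R x)"
            using ule[OF q, of x] sublinear_scale[OF sub[OF q], of c x] c by simp
        qed
        ultimately show ?thesis using c by (simp add: field_simps)
      qed
      obtain q where q: "q \<in> C" using ne by blast
      have "u x \<le> p x" for x using ule[OF q, of x] q CQ unfolding Q_def by (blast intro: order_trans)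
      then have "u \<in> Q" using add scale by (simp add: Q_def sublinear_def)
      then show ?thesis unfolding FR using ule CQ by (auto simp: R_def)
    qed
  qed
  then obtain q where q: "q \<in> Q" and min: "\<And>r. r \<in> Q \<Longrightarrow> (\<forall>x. r x \<le> q x) \<Longrightarrow> r = q"
    unfolding FR unfolding R_def by auto
  have "linear q"
  proof (rule minimal_sublinear_linear)
    show "sublinear q" using q by (simp add: Q_def)
    show "r = q" if "sublinear r" "\<And>x. r x \<le> q x" for r
      using that q by (intro min) (auto simp: Q_def intro: order_trans[of "r _" "q _" "p _"])
  qed
  then show ?thesis using q by (auto simp: Q_def)
qed

text \<open>
Lowering the norm first along \<open>y\<close> forces every linear minorant to be at most \<open>- norm y\<close> at \<open>- y\<close>,
hence to attain \<open>norm y\<close> at \<open>y\<close>.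
\<close>

lemma norming_functional:
  fixes y :: "'v::real_normed_vector"
  shows "\<exists>f. bounded_linear f \<and> f y = norm y \<and> (\<forall>x. \<bar>f x\<bar> \<le> norm x)"
proof -
  have n: "sublinear (norm :: 'v \<Rightarrow> real)" by (simp add: sublinear_def norm_triangle_ineq)
  obtain f where f: "linear f" and le: "\<And>x. f x \<le> slope_reduct norm y x"
    using linear_below_sublinear[OF sublinear_slope_reduct[OF n]] by blast
  have len: "f x \<le> norm x" for x using le[of x] slope_reduct_le[OF n, of 0 y x] by simp
  have abs: "\<bar>f x\<bar> \<le> norm x" for x
    using len[of x] len[of "- x"] linear_neg[OF f, of x] by simp
  have "f (- y) \<le> - norm y" using le[of "- y"] slope_reduct_le[OF n, of 1 y "- y"] by simp
  then have "f y = norm y" using len[of y] linear_neg[OF f, of y] by simp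
  moreover have "bounded_linear f"
    using f abs by (intro bounded_linear_intro[of f 1]) (auto simp: linear_add linear_scale)
  ultimately show ?thesis using abs by blast
qed

section \<open>Isomorphisms between subspaces\<close>

lemma isomorphic_spaces_image:
  fixes u :: "'a::real_normed_vector \<Rightarrow> 'b::real_normed_vector"
  assumes S: "subspace S"
    and add: "\<And>x y. x \<in> S \<Longrightarrow> y \<in> S \<Longrightarrow> u (x + y) = u x + u y"
    and scale: "\<And>c x. x \<in> S \<Longrightarrow> u (c *\<^sub>R x) = c *\<^sub>R u x"
    and upper: "\<And>x. x \<in> S \<Longrightarrow> norm (u x) \<le> C * norm x"
    and lower: "\<And>x. x \<in> S \<Longrightarrow> \<delta> * norm x \<le> norm (u x)" and \<delta>: "0 < \<delta>"
  shows "isomorphic_spaces (u ` S) S"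
proof -
  let ?f = "inv_into S u"
  have diff: "u (x - y) = u x - u y" if "x \<in> S" "y \<in> S" for x y
    using add[of "x - y" y] that subspace_diff[OF S] by simp
  have inj: "inj_on u S"
  proof (rule inj_onI)
    fix x y assume xy: "x \<in> S" "y \<in> S" "u x = u y"
    then have "\<delta> * norm (x - y) \<le> 0" using lower[of "x - y"] diff subspace_diff[OF S] by simp
    then show "x = y" using \<delta> by (simp add: mult_le_0_iff)
  qed
  have fu: "?f (u x) = x" if "x \<in> S" for x by (rule inv_into_f_f[OF inj that])
  have "subspace (u ` S)"
  proof (rule subspaceI)
    show "0 \<in> u ` S" using scale[of 0 0] subspace_0[OF S] by (metis image_eqI scaleR_zero_left)
    show "x + y \<in> u ` S" if "x \<in> u ` S" "y \<in> u ` S" for x y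
      using that add subspace_add[OF S] by (metis (no_types, lifting) image_iff)
    show "c *\<^sub>R x \<in> u ` S" if "x \<in> u ` S" for c x
      using that scale subspace_scale[OF S] by (metis (no_types, lifting) image_iff)
  qed
  moreover have "homeomorphism (u ` S) S ?f u"
  proof (rule homeomorphismI)
    show "continuous_on S u"
    proof (rule lipschitz_on_continuous_on, rule lipschitz_onI)
      show "dist (u x) (u y) \<le> max C 0 * dist x y" if "x \<in> S" "y \<in> S" for x y
        using upper[of "x - y"] diff[OF that] subspace_diff[OF S that]
        by (simp add: dist_norm) (smt (verit, best) mult_right_mono norm_ge_zero)
    qed simp
    show "continuous_on (u ` S) ?f"
    proof (rule lipschitz_on_continuous_on, rule lipschitz_onI)
      show "dist (?f x) (?f y) \<le> (1 / \<delta>) * dist x y" if "x \<in> u ` S" "y \<in> u ` S" for x y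
      proof -
        obtain a where a: "a \<in> S" "x = u a" using \<open>x \<in> u ` S\<close> by blast
        obtain b where b: "b \<in> S" "y = u b" using \<open>y \<in> u ` S\<close> by blast
        note ab = a(1) b(1) a(2) b(2)
        have "\<delta> * norm (a - b) \<le> norm (u a - u b)"
          using lower[OF subspace_diff[OF S ab(1,2)]] unfolding diff[OF ab(1,2)] .
        then show ?thesis using \<delta> ab by (simp add: dist_norm fu field_simps)
      qed
    qed (use \<delta> in simp)
  qed (auto simp: fu)
  moreover have "\<forall>x\<in>u ` S. \<forall>y\<in>u ` S. ?f (x + y) = ?f x + ?f y"
    using fu subspace_add[OF S] by (auto simp flip: add)
  moreover have "\<forall>c. \<forall>x\<in>u ` S. ?f (c *\<^sub>R x) = c *\<^sub>R ?f x"
    using fu subspace_scale[OF S] by (auto simp flip: scale)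
  ultimately show ?thesis unfolding isomorphic_spaces_def using S by blast
qed

lemma linear_continuous_on_subspace_bounded:
  fixes f :: "'a::real_normed_vector \<Rightarrow> 'b::real_normed_vector"
  assumes S: "subspace S" and scale: "\<And>c x. x \<in> S \<Longrightarrow> f (c *\<^sub>R x) = c *\<^sub>R f x"
    and cont: "continuous_on S f"
  shows "\<exists>C>0. \<forall>x\<in>S. norm (f x) \<le> C * norm x"
proof -
  have 0: "0 \<in> S" by (rule subspace_0[OF S])
  have f0: "f 0 = 0" using scale[OF 0, of 0] by simp
  obtain d where d: "0 < d" "\<And>x. x \<in> S \<Longrightarrow> dist x 0 < d \<Longrightarrow> dist (f x) (f 0) < 1"
    using cont 0 unfolding continuous_on_iff by (metis zero_less_one)
  have "norm (f x) \<le> (2 / d) * norm x" if x: "x \<in> S" for x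
  proof (cases "x = 0")
    case False
    let ?c = "d / (2 * norm x)"
    have "norm (f (?c *\<^sub>R x)) < 1"
      using d(2)[OF subspace_scale[OF S x], of ?c] d(1) False f0 by simp
    then have "?c * norm (f x) < 1" using scale[OF x] d(1) by simp
    then show ?thesis using d(1) False by (simp add: field_simps)
  qed (simp add: f0)
  then show ?thesis using d(1) by (intro exI[of _ "2 / d"]) auto
qed

lemma inverse_linear_on_subspace:
  assumes S: "subspace S" and add: "\<And>x y. x \<in> S \<Longrightarrow> y \<in> S \<Longrightarrow> f (x + y) = f x + f y"
    and scale: "\<And>c x. x \<in> S \<Longrightarrow> f (c *\<^sub>R x) = c *\<^sub>R f x"
    and gS: "\<And>y. y \<in> T \<Longrightarrow> g y \<in> S" and gf: "\<And>x. x \<in> S \<Longrightarrow> g (f x) = x"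
    and fg: "\<And>y. y \<in> T \<Longrightarrow> f (g y) = y"
  shows "y \<in> T \<Longrightarrow> y' \<in> T \<Longrightarrow> g (y + y') = g y + g y'" and "y \<in> T \<Longrightarrow> g (c *\<^sub>R y) = c *\<^sub>R g y"
proof -
  show "g (y + y') = g y + g y'" if "y \<in> T" "y' \<in> T"
    using gf[of "g y + g y'"] by (simp add: subspace_add[OF S] add gS fg that)
  show "g (c *\<^sub>R y) = c *\<^sub>R g y" if "y \<in> T"
    using gf[of "c *\<^sub>R g y"] by (simp add: subspace_scale[OF S] scale gS fg that)
qed

lemma isomorphic_spaces_sym:
  assumes "isomorphic_spaces S T"
  shows "isomorphic_spaces T S"
proof -
  obtain f g where S: "subspace S" and T: "subspace T" and h: "homeomorphism S T f g"
    and add: "\<And>x y. x \<in> S \<Longrightarrow> y \<in> S \<Longrightarrow> f (x + y) = f x + f y"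
    and scale: "\<And>c x. x \<in> S \<Longrightarrow> f (c *\<^sub>R x) = c *\<^sub>R f x"
    using assms unfolding isomorphic_spaces_def by blast
  have gS: "\<And>y. y \<in> T \<Longrightarrow> g y \<in> S" and gf: "\<And>x. x \<in> S \<Longrightarrow> g (f x) = x"
    and fg: "\<And>y. y \<in> T \<Longrightarrow> f (g y) = y"
    using h unfolding homeomorphism_def by auto
  have "g (y + y') = g y + g y'" if "y \<in> T" "y' \<in> T" for y y'
    by (rule inverse_linear_on_subspace(1)[of S f T g, OF S add scale gS gf fg that])
  moreover have "g (c *\<^sub>R y) = c *\<^sub>R g y" if "y \<in> T" for c y
    by (rule inverse_linear_on_subspace(2)[of S f T g, OF S add scale gS gf fg that])
  ultimately show ?thesis
    unfolding isomorphic_spaces_def using S T homeomorphism_symD[OF h] by blast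
qed

lemma isomorphic_spacesE:
  assumes "isomorphic_spaces S T"
  obtains f g C where "subspace S" "subspace T" "\<And>x. x \<in> S \<Longrightarrow> f x \<in> T" "\<And>y. y \<in> T \<Longrightarrow> g y \<in> S"
    "\<And>x. x \<in> S \<Longrightarrow> g (f x) = x" "\<And>y. y \<in> T \<Longrightarrow> f (g y) = y"
    "\<And>x x'. x \<in> S \<Longrightarrow> x' \<in> S \<Longrightarrow> f (x + x') = f x + f x'" "\<And>c x. x \<in> S \<Longrightarrow> f (c *\<^sub>R x) = c *\<^sub>R f x"
    "\<And>y y'. y \<in> T \<Longrightarrow> y' \<in> T \<Longrightarrow> g (y + y') = g y + g y'" "\<And>c y. y \<in> T \<Longrightarrow> g (c *\<^sub>R y) = c *\<^sub>R g y"
    "0 < C" "\<And>x. x \<in> S \<Longrightarrow> norm (f x) \<le> C * norm x" "\<And>y. y \<in> T \<Longrightarrow> norm (g y) \<le> C * norm y"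
proof -
  obtain f g where S: "subspace S" and T: "subspace T" and h: "homeomorphism S T f g"
    and add: "\<And>x y. x \<in> S \<Longrightarrow> y \<in> S \<Longrightarrow> f (x + y) = f x + f y"
    and scale: "\<And>c x. x \<in> S \<Longrightarrow> f (c *\<^sub>R x) = c *\<^sub>R f x"
    using assms unfolding isomorphic_spaces_def by blast
  have fT: "\<And>x. x \<in> S \<Longrightarrow> f x \<in> T" and gS: "\<And>y. y \<in> T \<Longrightarrow> g y \<in> S"
    and gf: "\<And>x. x \<in> S \<Longrightarrow> g (f x) = x" and fg: "\<And>y. y \<in> T \<Longrightarrow> f (g y) = y"
    and cf: "continuous_on S f" and cg: "continuous_on T g"
    using h unfolding homeomorphism_def by auto
  have g_add: "g (y + y') = g y + g y'" if "y \<in> T" "y' \<in> T" for y y'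
    by (rule inverse_linear_on_subspace(1)[of S f T g, OF S add scale gS gf fg that])
  have g_scale: "g (c *\<^sub>R y) = c *\<^sub>R g y" if "y \<in> T" for c y
    by (rule inverse_linear_on_subspace(2)[of S f T g, OF S add scale gS gf fg that])
  obtain C where C: "0 < C" "\<And>x. x \<in> S \<Longrightarrow> norm (f x) \<le> C * norm x"
    using linear_continuous_on_subspace_bounded[OF S scale cf] by blast
  obtain D where D: "0 < D" "\<And>y. y \<in> T \<Longrightarrow> norm (g y) \<le> D * norm y"
    using linear_continuous_on_subspace_bounded[OF T g_scale cg] by blast
  show ?thesis
  proof (rule that[of f g "max C D"])
    show "norm (f x) \<le> max C D * norm x" if "x \<in> S" for x
      using C(2)[OF that] mult_right_mono[OF max.cobounded1[of C D] norm_ge_zero[of x]] by linarith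
    show "norm (g y) \<le> max C D * norm y" if "y \<in> T" for y
      using D(2)[OF that] mult_right_mono[OF max.cobounded2[of D C] norm_ge_zero[of y]] by linarith
  qed (use S T fT gS gf fg add scale g_add g_scale C(1) in auto)
qed

section \<open>Rosenthal's disjointness lemma\<close>

text \<open>
Split an infinite index set into infinitely many infinite pieces.  If no piece is good, each piece
has a bad index \<open>n\<close>, whose \<open>\<nu> n\<close> spends more than \<open>\<epsilon>\<close> on that piece; on the infinite set of these
bad indices every \<open>\<nu> n\<close> has therefore lost \<open>\<epsilon>\<close> of its mass.  The mass is bounded, so this
happens only finitely often.
\<close>

lemma rosenthal_lemma:
  fixes \<nu> :: "nat \<Rightarrow> nat set \<Rightarrow> real"
  assumes super: "\<And>n A B D. A \<inter> B = {} \<Longrightarrow> A \<union> B \<subseteq> D \<Longrightarrow> \<nu> n A + \<nu> n B \<le> \<nu> n D"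
    and bound: "\<And>n A. \<nu> n A \<le> C" and \<epsilon>: "0 < \<epsilon>"
  shows "\<exists>M. infinite M \<and> (\<forall>n\<in>M. \<nu> n (M - {n}) \<le> \<epsilon>)"
proof -
  have main: "\<exists>M\<subseteq>Q. infinite M \<and> (\<forall>n\<in>M. \<nu> n (M - {n}) \<le> \<epsilon>)"
    if "infinite Q" "\<forall>n\<in>Q. \<nu> n (Q - {n}) \<le> real (Suc r) * \<epsilon>" for r Q
    using that
  proof (induction r arbitrary: Q)
    case 0 then show ?case by auto
  next
    case (Suc r)
    let ?e = "enumerate Q"
    have e: "bij_betw ?e UNIV Q" by (rule bij_enumerate[OF Suc.prems(1)])
    then have einj: "inj ?e" by (auto simp: bij_betw_def)
    define N where "N i = range (\<lambda>j. ?e (prod_encode (i, j)))" for i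
    have Ninf: "infinite (N i)" for i
      unfolding N_def by (rule range_inj_infinite) (auto simp: inj_def dest: injD[OF einj])
    have NQ: "N i \<subseteq> Q" for i using e unfolding N_def bij_betw_def by auto
    have Ndisj: "i = i'" if "x \<in> N i" "x \<in> N i'" for i i' x
      using that unfolding N_def by (auto dest: injD[OF einj])
    show ?case
    proof (cases "\<exists>i. \<forall>n\<in>N i. \<nu> n (N i - {n}) \<le> \<epsilon>")
      case True then show ?thesis using Ninf NQ by blast
    next
      case False
      then obtain m where m: "\<And>i. m i \<in> N i" "\<And>i. \<epsilon> < \<nu> (m i) (N i - {m i})"
        by (metis not_le)
      have minj: "inj m" using m(1) Ndisj by (metis injI)
      have "\<nu> n (range m - {n}) \<le> real (Suc r) * \<epsilon>" if n: "n \<in> range m" for n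
      proof -
        obtain i where i: "n = m i" using n by blast
        have "(range m - {n}) \<inter> (N i - {n}) = {}" using m(1) Ndisj unfolding i by blast
        moreover have "(range m - {n}) \<union> (N i - {n}) \<subseteq> Q - {n}" using m(1) NQ by blast
        ultimately have "\<nu> n (range m - {n}) + \<nu> n (N i - {n}) \<le> \<nu> n (Q - {n})" by (rule super)
        also have "\<dots> \<le> real (Suc (Suc r)) * \<epsilon>" using Suc.prems(2) m(1) NQ i by blast
        finally show ?thesis using m(2)[of i] i by (simp add: algebra_simps)
      qed
      then obtain M where "M \<subseteq> range m" "infinite M" "\<forall>n\<in>M. \<nu> n (M - {n}) \<le> \<epsilon>"
        using Suc.IH[of "range m"] range_inj_infinite[OF minj] by blast
      moreover have "range m \<subseteq> Q" using m(1) NQ by blast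
      ultimately show ?thesis by blast
    qed
  qed
  obtain r where "C / \<epsilon> \<le> real r" using real_arch_simple by blast
  then have "C \<le> real r * \<epsilon>" using \<epsilon> by (simp add: field_simps)
  then have "\<forall>n\<in>UNIV. \<nu> n (UNIV - {n}) \<le> real (Suc r) * \<epsilon>"
    using bound \<epsilon> by (auto intro!: order_trans[OF bound] simp: algebra_simps)
  then show ?thesis using main[of UNIV r] by auto
qed

text \<open>
The superadditive set functions are the variations of the functionals.  The class \<open>T\<close> of admissible
coefficient sequences is a parameter because the lemma serves finitely supported sequences (for the
Bessaga-Pelczynski theorem) as well as all bounded ones (for the theorem on complemented \<open>c\<^sub>0\<close>-sums).
\<close>

lemma rosenthal_functionals:
  fixes \<Lambda> :: "nat \<Rightarrow> (nat \<Rightarrow> real) \<Rightarrow> real"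
  assumes T: "(\<lambda>_. 0) \<in> T" "\<And>s t. s \<in> T \<Longrightarrow> t \<in> T \<Longrightarrow> (\<lambda>j. s j + t j) \<in> T"
    and add: "\<And>n s t. s \<in> T \<Longrightarrow> t \<in> T \<Longrightarrow> \<Lambda> n (\<lambda>j. s j + t j) = \<Lambda> n s + \<Lambda> n t"
    and bound: "\<And>n t. t \<in> T \<Longrightarrow> (\<And>j. \<bar>t j\<bar> \<le> 1) \<Longrightarrow> \<Lambda> n t \<le> C" and \<epsilon>: "0 < \<epsilon>"
  obtains M where "infinite M"
    "\<And>n t. n \<in> M \<Longrightarrow> t \<in> T \<Longrightarrow> (\<And>j. \<bar>t j\<bar> \<le> 1) \<Longrightarrow> (\<And>j. t j \<noteq> 0 \<Longrightarrow> j \<in> M - {n}) \<Longrightarrow> \<Lambda> n t \<le> \<epsilon>"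
proof -
  define U where "U A = {t \<in> T. (\<forall>j. \<bar>t j\<bar> \<le> 1) \<and> (\<forall>j. t j \<noteq> 0 \<longrightarrow> j \<in> A)}" for A
  define \<nu> where "\<nu> n A = (SUP t\<in>U A. \<Lambda> n t)" for n A
  have ne: "U A \<noteq> {}" for A using T(1) by (auto simp: U_def)
  have bdd: "bdd_above (\<Lambda> n ` U A)" for n A
    by (rule bdd_aboveI2[where M=C]) (auto simp: U_def intro: bound)
  have up: "\<Lambda> n t \<le> \<nu> n A" if "t \<in> U A" for n t A
    unfolding \<nu>_def by (rule cSUP_upper[OF that bdd])
  have least: "\<nu> n A \<le> a" if "\<And>t. t \<in> U A \<Longrightarrow> \<Lambda> n t \<le> a" for n A a
    unfolding \<nu>_def by (rule cSUP_least[OF ne that])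
  have "\<nu> n A + \<nu> n B \<le> \<nu> n D" if AB: "A \<inter> B = {}" "A \<union> B \<subseteq> D" for n A B D
  proof -
    have "\<Lambda> n s + \<Lambda> n t \<le> \<nu> n D" if s: "s \<in> U A" and t: "t \<in> U B" for s t
    proof -
      have "s j = 0 \<or> t j = 0" for j using s t AB by (auto simp: U_def)
      moreover have "\<bar>s j\<bar> \<le> 1" "\<bar>t j\<bar> \<le> 1" for j using s t by (auto simp: U_def)
      ultimately have "\<bar>s j + t j\<bar> \<le> 1" for j by (metis add.left_neutral add.right_neutral)
      moreover have "j \<in> D" if "s j + t j \<noteq> 0" for j
      proof -
        have "s j \<noteq> 0 \<or> t j \<noteq> 0" using that by auto
        then show ?thesis using s t AB by (auto simp: U_def)
      qed
      ultimately have "(\<lambda>j. s j + t j) \<in> U D" using s t T(2) by (simp add: U_def)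
      then have "\<Lambda> n (\<lambda>j. s j + t j) \<le> \<nu> n D" by (rule up)
      then show ?thesis using add[of s t n] s t by (simp add: U_def)
    qed
    then have "\<nu> n A \<le> \<nu> n D - \<Lambda> n t" if "t \<in> U B" for t
      using that by (intro least) (simp add: le_diff_eq)
    then have "\<nu> n B \<le> \<nu> n D - \<nu> n A" by (intro least) (simp add: le_diff_eq add.commute)
    then show ?thesis by simp
  qed
  moreover have "\<nu> n A \<le> C" for n A by (rule least) (auto simp: U_def intro: bound)
  ultimately obtain M where M: "infinite M" "\<forall>n\<in>M. \<nu> n (M - {n}) \<le> \<epsilon>"
    using rosenthal_lemma[of \<nu> C \<epsilon>] \<epsilon> by blast
  show ?thesis
  proof (rule that[OF M(1)])
    fix n t assume "n \<in> M" "t \<in> T" "\<And>j. \<bar>t j\<bar> \<le> 1" "\<And>j. t j \<noteq> 0 \<Longrightarrow> j \<in> M - {n}"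
    then have "\<Lambda> n t \<le> \<nu> n (M - {n})" by (intro up) (auto simp: U_def)
    then show "\<Lambda> n t \<le> \<epsilon>" using M(2) \<open>n \<in> M\<close> by force
  qed
qed

section \<open>Spaces without copies of \<open>c\<^sub>0\<close>\<close>

lemma finite_sums_scaled:
  fixes x :: "nat \<Rightarrow> 'y::real_normed_vector"
  assumes bound: "\<And>t F. finite F \<Longrightarrow> (\<And>j. \<bar>t j\<bar> \<le> 1) \<Longrightarrow> norm (\<Sum>j\<in>F. t j *\<^sub>R x j) \<le> C"
    and F: "finite F" and m: "0 \<le> m" and t: "\<And>j. j \<in> F \<Longrightarrow> \<bar>t j\<bar> \<le> m"
  shows "norm (\<Sum>j\<in>F. t j *\<^sub>R x j) \<le> C * m"
proof (cases "0 < m")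
  case True
  define t' where "t' j = (if j \<in> F then t j / m else 0)" for j
  have "norm (\<Sum>j\<in>F. t' j *\<^sub>R x j) \<le> C"
    by (rule bound[OF F]) (use t True in \<open>auto simp: t'_def abs_mult\<close>)
  moreover have "(\<Sum>j\<in>F. t j *\<^sub>R x j) = m *\<^sub>R (\<Sum>j\<in>F. t' j *\<^sub>R x j)"
    unfolding scaleR_sum_right by (rule sum.cong) (use True in \<open>auto simp: t'_def\<close>)
  ultimately show ?thesis using True by (simp add: mult.commute)
next
  case False
  then show ?thesis using m t by simp
qed

text \<open>
The hypotheses say that \<open>x\<close> behaves like the unit vector basis of \<open>c\<^sub>0\<close> on finite sums; the upper
estimate makes the series converge for every null sequence of coefficients.
\<close>

lemma contains_c0_if_c0_basis:
  fixes x :: "nat \<Rightarrow> 'y::banach"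
  assumes bound: "\<And>t F. finite F \<Longrightarrow> (\<And>j. \<bar>t j\<bar> \<le> 1) \<Longrightarrow> norm (\<Sum>j\<in>F. t j *\<^sub>R x j) \<le> C"
    and lower: "\<And>t F i. finite F \<Longrightarrow> i \<in> F \<Longrightarrow> \<delta> * \<bar>t i\<bar> \<le> norm (\<Sum>j\<in>F. t j *\<^sub>R x j)"
    and \<delta>: "0 < \<delta>"
  shows "contains_c0 TYPE('y)"
proof -
  have C: "0 \<le> C" using bound[of "{}" "\<lambda>_. 0"] by simp
  have scaled: "norm (\<Sum>j\<in>F. t j *\<^sub>R x j) \<le> C * m" if "finite F" "0 \<le> m" "\<And>j. j \<in> F \<Longrightarrow> \<bar>t j\<bar> \<le> m" for F t m
    by (rule finite_sums_scaled[OF bound that])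
  define u where "u a = (\<Sum>j. apply_bcontfun a j *\<^sub>R x j)" for a :: "nat \<Rightarrow>\<^sub>C real"
  have summ: "summable (\<lambda>j. apply_bcontfun a j *\<^sub>R x j)" if a: "a \<in> c0_space" for a
    unfolding summable_Cauchy
  proof (intro allI impI)
    fix e :: real assume e: "0 < e"
    define m where "m = e / (C + 1)"
    have m: "0 < m" "C * m < e" using e C by (auto simp: m_def field_simps)
    have "apply_bcontfun a \<longlonglongrightarrow> 0" using a by (simp add: c0_space_def)
    then obtain N where "\<And>j. N \<le> j \<Longrightarrow> \<bar>apply_bcontfun a j\<bar> < m"
      using LIMSEQ_D[of "apply_bcontfun a" 0 m] m by auto
    then have "norm (\<Sum>j\<in>{k..<n}. apply_bcontfun a j *\<^sub>R x j) \<le> C * m" if "N \<le> k" for k n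
      using that m(1) by (intro scaled) (auto intro: less_imp_le)
    then show "\<exists>N. \<forall>k\<ge>N. \<forall>n. norm (\<Sum>j\<in>{k..<n}. apply_bcontfun a j *\<^sub>R x j) < e"
      using m(2) by (meson le_less_trans)
  qed
  have lim: "(\<lambda>n. \<Sum>j<n. apply_bcontfun a j *\<^sub>R x j) \<longlonglongrightarrow> u a" if "a \<in> c0_space" for a
    unfolding u_def by (rule summable_LIMSEQ[OF summ[OF that]])
  have "isomorphic_spaces (u ` c0_space) (c0_space :: (nat \<Rightarrow>\<^sub>C real) set)"
  proof (rule isomorphic_spaces_image[where C=C and \<delta>=\<delta>])
    show "subspace (c0_space :: (nat \<Rightarrow>\<^sub>C real) set)" by (rule subspace_c0_space)
    show "0 < \<delta>" by (rule \<delta>)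
    show "u (a + b) = u a + u b" if "a \<in> c0_space" "b \<in> c0_space" for a b
      unfolding u_def by (simp add: scaleR_add_left suminf_add[OF summ summ] that)
    show "u (c *\<^sub>R a) = c *\<^sub>R u a" if "a \<in> c0_space" for c a
      unfolding u_def by (simp add: suminf_scaleR_right[OF summ[OF that]])
    show "norm (u a) \<le> C * norm a" if a: "a \<in> c0_space" for a
      by (rule Lim_bounded[OF tendsto_norm[OF lim[OF a]], of 0])
        (auto intro!: scaled simp flip: real_norm_def intro: norm_bounded)
    show "\<delta> * norm a \<le> norm (u a)" if a: "a \<in> c0_space" for a
    proof -
      have "norm (apply_bcontfun a i) \<le> norm (u a) / \<delta>" for i
      proof -
        have "\<delta> * \<bar>apply_bcontfun a i\<bar> \<le> norm (u a)"
          by (rule Lim_bounded2[OF tendsto_norm[OF lim[OF a]], of "Suc i"]) (auto intro!: lower)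
        then show ?thesis using \<delta> by (simp add: field_simps)
      qed
      then have "norm a \<le> norm (u a) / \<delta>" by (rule norm_bound)
      then show ?thesis using \<delta> by (simp add: field_simps)
    qed
  qed
  then show ?thesis unfolding contains_c0_def by blast
qed

text \<open>
Norming functionals for the \<open>y n\<close> turn boundedness of the sums into uniformly bounded variations.
After passing to the subsequence from Rosenthal's lemma, the functional of the largest coefficient
sees that coefficient almost undisturbed, so the subsequence spans \<open>c\<^sub>0\<close>.
\<close>

lemma bessaga_pelczynski:
  fixes y :: "nat \<Rightarrow> 'y::banach"
  assumes c0: "\<not> contains_c0 TYPE('y)"
    and bound: "\<And>t F. finite F \<Longrightarrow> (\<And>j. \<bar>t j\<bar> \<le> 1) \<Longrightarrow> norm (\<Sum>j\<in>F. t j *\<^sub>R y j) \<le> C"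
    and \<epsilon>: "0 < \<epsilon>"
  shows "\<exists>n. norm (y n) < \<epsilon>"
proof (rule ccontr)
  assume "\<not> ?thesis"
  then have big: "\<epsilon> \<le> norm (y n)" for n by (simp add: not_less)
  have "\<forall>n. \<exists>f. bounded_linear f \<and> f (y n) = norm (y n) \<and> (\<forall>x. \<bar>f x\<bar> \<le> norm x)"
    using norming_functional by blast
  then obtain f where f: "\<And>n. bounded_linear (f n)" "\<And>n. f n (y n) = norm (y n)" "\<And>n x. \<bar>f n x\<bar> \<le> norm x"
    by metis
  define T where "T = {t :: nat \<Rightarrow> real. finite {j. t j \<noteq> 0}}"
  define L where "L t = (\<Sum>j\<in>{j. t j \<noteq> 0}. t j *\<^sub>R y j)" for t
  have L: "L t = (\<Sum>j\<in>F. t j *\<^sub>R y j)" if "finite F" "\<And>j. t j \<noteq> 0 \<Longrightarrow> j \<in> F" for t F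
    unfolding L_def by (rule sum.mono_neutral_left) (use that in auto)
  obtain M where M: "infinite M"
    and small: "\<And>n t. n \<in> M \<Longrightarrow> t \<in> T \<Longrightarrow> (\<And>j. \<bar>t j\<bar> \<le> 1) \<Longrightarrow> (\<And>j. t j \<noteq> 0 \<Longrightarrow> j \<in> M - {n})
        \<Longrightarrow> f n (L t) \<le> \<epsilon> / 2"
  proof (rule rosenthal_functionals[of T "\<lambda>n t. f n (L t)" C "\<epsilon> / 2"])
    show "(\<lambda>_. 0) \<in> T" by (simp add: T_def)
    fix s t assume st: "s \<in> T" "t \<in> T"
    let ?F = "{j. s j \<noteq> 0} \<union> {j. t j \<noteq> 0}"
    have F: "finite ?F" using st by (simp add: T_def)
    show "(\<lambda>j. s j + t j) \<in> T" unfolding T_def mem_Collect_eq by (rule finite_subset[OF _ F]) auto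
    have "L (\<lambda>j. s j + t j) = L s + L t"
      using L[OF F, of s] L[OF F, of t] L[OF F, of "\<lambda>j. s j + t j"]
      by (auto simp: scaleR_add_left sum.distrib)
    then show "f n (L (\<lambda>j. s j + t j)) = f n (L s) + f n (L t)" for n
      using linear_add[OF bounded_linear.linear[OF f(1)]] by simp
  next
    fix n t assume "t \<in> T" "\<And>j. \<bar>t j :: real\<bar> \<le> 1"
    then have "norm (L t) \<le> C" unfolding L_def by (intro bound) (auto simp: T_def)
    then show "f n (L t) \<le> C" using f(3)[of n "L t"] by linarith
  qed (use \<epsilon> in auto)
  define r where "r = enumerate M"
  have rM: "r j \<in> M" for j unfolding r_def by (rule enumerate_in_set[OF M])
  have rinj: "inj r" unfolding r_def using strict_mono_enumerate[OF M] strict_mono_imp_inj_on by blast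
  have "contains_c0 TYPE('y)"
  proof (rule contains_c0_if_c0_basis[of "\<lambda>j. y (r j)"])
    show "norm (\<Sum>j\<in>F. t j *\<^sub>R y (r j)) \<le> C" if "finite F" "\<And>j. \<bar>t j\<bar> \<le> 1" for t F
    proof -
      have "(\<Sum>j\<in>F. t j *\<^sub>R y (r j)) = (\<Sum>i\<in>r ` F. t (inv r i) *\<^sub>R y i)"
        by (subst sum.reindex) (auto simp: rinj intro: inj_on_subset[OF rinj])
      also have "norm \<dots> \<le> C" by (rule bound) (use that in auto)
      finally show ?thesis .
    qed
    show "\<epsilon> / 2 * \<bar>t i\<bar> \<le> norm (\<Sum>j\<in>F. t j *\<^sub>R y (r j))" if F: "finite F" "i \<in> F" for t F i
    proof -
      have "Max ((\<lambda>j. \<bar>t j\<bar>) ` F) \<in> (\<lambda>j. \<bar>t j\<bar>) ` F"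
        by (rule Max_in) (use F in auto)
      then obtain k where k': "k \<in> F" "Max ((\<lambda>j. \<bar>t j\<bar>) ` F) = \<bar>t k\<bar>" by blast
      then have k: "k \<in> F" "\<And>j. j \<in> F \<Longrightarrow> \<bar>t j\<bar> \<le> \<bar>t k\<bar>"
        using F(1) by (auto simp flip: k'(2))
      show ?thesis
      proof (cases "t k = 0")
        case True
        then show ?thesis using k(2)[OF F(2)] by simp
      next
        case False
        \<comment> \<open>the disturbance of the largest coefficient, normalised so that Rosenthal's estimate applies\<close>
        define s where "s i = (if i \<in> r ` (F - {k}) then - t (inv r i) / t k else 0)" for i
        have sr: "s (r j) = (if j \<in> F - {k} then - t j / t k else 0)" for j
          unfolding s_def using inj_image_mem_iff[OF rinj, of j "F - {k}"] inv_f_f[OF rinj] by simp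
        have sm: "f (r k) (L s) \<le> \<epsilon> / 2"
        proof (rule small[OF rM])
          show "s \<in> T" unfolding T_def mem_Collect_eq
            by (rule finite_subset[of _ "r ` F"]) (use F in \<open>auto simp: s_def\<close>)
          show "\<bar>s j\<bar> \<le> 1" for j
          proof (cases "j \<in> r ` (F - {k})")
            case True
            then obtain i where "i \<in> F - {k}" "j = r i" by blast
            then have "i \<in> F" "s j = - t i / t k" by (auto simp: sr)
            then show ?thesis using k(2)[of i] False by (simp add: abs_divide)
          qed (simp add: s_def)
          show "j \<in> M - {r k}" if "s j \<noteq> 0" for j
          proof -
            have "j \<in> r ` (F - {k})" using that by (simp add: s_def split: if_splits)
            then show ?thesis using rM rinj by (auto simp: inj_eq)
          qed
        qed
        have "L s = (\<Sum>i\<in>r ` (F - {k}). s i *\<^sub>R y i)"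
          by (rule L) (use F in \<open>auto simp: s_def split: if_splits\<close>)
        then have Ls: "L s = (\<Sum>j\<in>F - {k}. s (r j) *\<^sub>R y (r j))"
          by (subst (asm) sum.reindex) (auto intro: inj_on_subset[OF rinj])
        have "(\<Sum>j\<in>F. t j *\<^sub>R y (r j)) = t k *\<^sub>R y (r k) + (\<Sum>j\<in>F - {k}. t j *\<^sub>R y (r j))"
          by (rule sum.remove) (use F k in auto)
        also have "(\<Sum>j\<in>F - {k}. t j *\<^sub>R y (r j)) = - (t k *\<^sub>R L s)"
          unfolding Ls scaleR_sum_right sum_negf[symmetric] by (rule sum.cong) (use False in \<open>auto simp: sr\<close>)
        finally have eq: "(\<Sum>j\<in>F. t j *\<^sub>R y (r j)) = t k *\<^sub>R (y (r k) - L s)" by (simp add: scaleR_diff_right)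
        have "f (r k) (y (r k) - L s) \<ge> \<epsilon> - \<epsilon> / 2"
          using linear_diff[OF bounded_linear.linear[OF f(1)]] f(2)[of "r k"] big[of "r k"] sm by simp
        then have "\<epsilon> / 2 \<le> norm (y (r k) - L s)" using f(3)[of "r k" "y (r k) - L s"] by linarith
        then have "\<bar>t k\<bar> * (\<epsilon> / 2) \<le> \<bar>t k\<bar> * norm (y (r k) - L s)" by (intro mult_left_mono) auto
        moreover have "\<epsilon> / 2 * \<bar>t i\<bar> \<le> \<bar>t k\<bar> * (\<epsilon> / 2)" using k(2)[OF F(2)] \<epsilon> by (simp add: mult.commute)
        ultimately show ?thesis unfolding eq by simp
      qed
    qed
  qed (use \<epsilon> in simp)
  then show False using c0 by simp
qed

section \<open>Simons' lemma\<close>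

text \<open>
Completeness is a hypothesis here, and not a sort: the lemma is meant for spaces of continuous
functions over arbitrary topological spaces.
\<close>

lemma summable_if_complete:
  fixes f :: "nat \<Rightarrow> 'v::real_normed_vector"
  assumes V: "complete (UNIV :: 'v set)" and le: "\<And>n. N \<le> n \<Longrightarrow> norm (f n) \<le> g n" and g: "summable g"
  shows "summable f"
proof -
  have "Cauchy (\<lambda>n. \<Sum>k<n. f k)"
  proof (rule metric_CauchyI)
    fix e :: real assume "0 < e"
    then obtain M where M: "\<And>m n. M \<le> m \<Longrightarrow> norm (\<Sum>k\<in>{m..<n}. g k) < e"
      using g unfolding summable_Cauchy by blast
    have le': "norm ((\<Sum>k<n. f k) - (\<Sum>k<m. f k)) < e" if "max M N \<le> m" "m \<le> n" for m n
    proof -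
      have "(\<Sum>k<n. f k) - (\<Sum>k<m. f k) = (\<Sum>k\<in>{m..<n}. f k)"
        using sum_diff_nat_ivl[of 0 m n f] that by (simp add: atLeast0LessThan)
      also have "norm \<dots> \<le> (\<Sum>k\<in>{m..<n}. g k)" by (rule sum_norm_le) (use le that in auto)
      also have "\<dots> < e" using M[of m n] that by auto
      finally show ?thesis .
    qed
    have "dist (\<Sum>k<m. f k) (\<Sum>k<n. f k) < e" if "max M N \<le> m" "max M N \<le> n" for m n
      using le'[of m n] le'[of n m] that by (cases "m \<le> n") (auto simp: dist_norm norm_minus_commute)
    then show "\<exists>M. \<forall>m\<ge>M. \<forall>n\<ge>M. dist (\<Sum>k<m. f k) (\<Sum>k<n. f k) < e" by blast
  qed
  then obtain l where "(\<lambda>n. \<Sum>k<n. f k) \<longlonglongrightarrow> l" using V unfolding complete_def by blast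
  then show ?thesis unfolding summable_iff_convergent by (rule convergentI)
qed

lemma complete_bcontfun:
  "complete (UNIV :: ('a::topological_space \<Rightarrow>\<^sub>C 'b::complete_space) set)"
  unfolding complete_def
proof (intro allI impI)
  fix f :: "nat \<Rightarrow> 'a \<Rightarrow>\<^sub>C 'b"
  assume "(\<forall>n. f n \<in> UNIV) \<and> Cauchy f"
  then have "\<forall>e>0. \<exists>M. \<forall>m n x. M \<le> m \<and> M \<le> n \<and> True \<longrightarrow> dist (apply_bcontfun (f m) x) (apply_bcontfun (f n) x) < e"
    unfolding Cauchy_def by (metis dist_fun_lt_imp_dist_val_lt)
  then obtain g where "uniform_limit UNIV (\<lambda>n. apply_bcontfun (f n)) g sequentially"
    using uniformly_convergent_eq_cauchy[of "\<lambda>_. True" "\<lambda>n. apply_bcontfun (f n)"]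
    unfolding uniform_limit_sequentially_iff by meson
  then obtain l where "f \<longlonglongrightarrow> l" using uniform_limit_bcontfunE[OF _ sequentially_bot] by metis
  then show "\<exists>l\<in>UNIV. f \<longlonglongrightarrow> l" by blast
qed

text \<open>
Completing a partial sum with its missing weight \<open>(1/2)^m\<close> gives a genuine convex combination.
\<close>

lemma dyadic_convex_sum:
  fixes y :: "nat \<Rightarrow> 'v::real_normed_vector"
  assumes V: "complete (UNIV :: 'v set)" and D: "closed D" "convex D" and y: "\<And>j. y j \<in> D" and b: "\<And>j. norm (y j) \<le> B"
  shows "summable (\<lambda>j. (1/2)^Suc j *\<^sub>R y j)" "(\<Sum>j. (1/2)^Suc j *\<^sub>R y j) \<in> D"
proof -
  show s: "summable (\<lambda>j. (1/2)^Suc j *\<^sub>R y j)"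
  proof (rule summable_if_complete[OF V])
    show "summable (\<lambda>j. (1/2)^Suc j * B)"
      by (intro summable_mult2) (simp add: summable_mult summable_geometric)
    show "norm ((1/2)^Suc j *\<^sub>R y j) \<le> (1/2)^Suc j * B" if "0 \<le> j" for j
      using b[of j] by simp
  qed
  have mem: "(\<Sum>j<m. (1/2)^Suc j *\<^sub>R u j) + (1/2)^m *\<^sub>R x \<in> D"
    if "\<And>j. u j \<in> D" "x \<in> D" for m u x
    using that(1)
  proof (induction m arbitrary: u)
    case 0 then show ?case using that by simp
  next
    case (Suc m)
    have "(\<Sum>j<Suc m. (1/2)^Suc j *\<^sub>R u j) + (1/2)^Suc m *\<^sub>R x
        = (1/2) *\<^sub>R u 0 + (1/2) *\<^sub>R ((\<Sum>j<m. (1/2)^Suc j *\<^sub>R u (Suc j)) + (1/2)^m *\<^sub>R x)"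
      by (simp add: sum.lessThan_Suc_shift scaleR_sum_right scaleR_add_right del: sum.lessThan_Suc)
    also have "\<dots> \<in> D"
      by (rule convexD[OF D(2)]) (use Suc in auto)
    finally show ?case .
  qed
  have "(\<lambda>m. (\<Sum>j<m. (1/2)^Suc j *\<^sub>R y j) + (1/2)^m *\<^sub>R y 0)
      \<longlonglongrightarrow> (\<Sum>j. (1/2)^Suc j *\<^sub>R y j) + 0 *\<^sub>R y 0"
    by (intro tendsto_intros summable_LIMSEQ[OF s] LIMSEQ_power_zero) simp
  moreover have "\<forall>m. (\<Sum>j<m. (1/2)^Suc j *\<^sub>R y j) + (1/2)^m *\<^sub>R y 0 \<in> D"
    using mem y by blast
  ultimately show "(\<Sum>j. (1/2)^Suc j *\<^sub>R y j) \<in> D"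
    using closed_sequentially[OF D(1)] by fastforce
qed

text \<open>
If every element of \<open>C 0\<close> is large somewhere on the compact set \<open>S\<close>, then a single point of \<open>S\<close>
sees large elements arbitrarily far down the decreasing sequence \<open>C\<close>.  This replaces the appeal to
dominated convergence and Mazur's theorem.

Choose \<open>y n\<close> in \<open>C n\<close> greedily so that the partial sums \<open>z n\<close> of the series
\<open>u = (\<Sum>j. (1/2)^Suc j *\<^sub>R y j)\<close> have almost least possible supremum norm \<open>s\<close>.  The
tail after \<open>z n\<close> is \<open>(1/2)^n\<close> times an element \<open>w n\<close> of \<open>C n\<close>, and taking \<open>w n\<close> as a competitor for
\<open>y n\<close> shows that \<open>s\<close> must still grow by about \<open>(1/2)^n * s u\<close> beyond \<open>z n\<close>.  At a point where \<open>u\<close>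
attains its norm this growth has to come from \<open>w n\<close>.
\<close>

lemma simons_lemma:
  fixes C :: "nat \<Rightarrow> 'v::real_normed_vector set" and E :: "'v \<Rightarrow> 'p::topological_space \<Rightarrow> 'y::real_normed_vector"
  assumes V: "complete (UNIV :: 'v set)" and S: "compact S"
    and cont: "\<And>v. continuous_on S (E v)"
    and lin: "\<And>p. p \<in> S \<Longrightarrow> linear (\<lambda>v. E v p)"
    and bdd: "\<And>v p. p \<in> S \<Longrightarrow> norm (E v p) \<le> B * norm v"
    and C: "\<And>n. closed (C n)" "\<And>n. convex (C n)" "\<And>n. C n \<noteq> {}" "\<And>n. C (Suc n) \<subseteq> C n"
    and C_bdd: "\<And>v. v \<in> C 0 \<Longrightarrow> norm v \<le> M"
    and big: "\<And>v. v \<in> C 0 \<Longrightarrow> \<exists>p\<in>S. c \<le> norm (E v p)"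
    and c: "c' < c"
  shows "\<exists>p\<in>S. \<forall>n. \<exists>v\<in>C n. c' \<le> norm (E v p)"
proof -
  define s where "s v = (SUP p\<in>S. norm (E v p))" for v
  define \<eta> where "\<eta> = c - c'"
  have \<eta>: "0 < \<eta>" using c by (simp add: \<eta>_def)
  have ne: "S \<noteq> {}" using big C(3)[of 0] by blast
  have sbd: "bdd_above ((\<lambda>p. norm (E v p)) ` S)" for v
    by (rule bdd_aboveI2[where M="B * norm v"]) (rule bdd)
  have les: "norm (E v p) \<le> s v" if "p \<in> S" for v p
    unfolding s_def by (rule cSUP_upper[OF that sbd])
  have sle: "s v \<le> a" if "\<And>p. p \<in> S \<Longrightarrow> norm (E v p) \<le> a" for v a
    unfolding s_def by (rule cSUP_least[OF ne]) (use that in auto)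
  have s_nonneg: "0 \<le> s v" for v
    using ne les norm_ge_zero order_trans by (metis ex_in_conv)
  have half: "s ((1/2) *\<^sub>R (v + w)) \<le> (s v + s w) / 2" for v w
  proof (rule sle)
    fix p assume p: "p \<in> S"
    have "norm (E ((1/2) *\<^sub>R (v + w)) p) = norm (E v p + E w p) / 2"
      using linear_scale[OF lin[OF p]] linear_add[OF lin[OF p]] by simp
    also have "\<dots> \<le> (norm (E v p) + norm (E w p)) / 2"
      using norm_triangle_ineq[of "E v p" "E w p"] by simp
    finally show "norm (E ((1/2) *\<^sub>R (v + w)) p) \<le> (s v + s w) / 2"
      using les[OF p, of v] les[OF p, of w] by simp
  qed
  have CC: "C n \<subseteq> C m" if "m \<le> n" for m n
    using that by (rule lift_Suc_antimono_le[rotated]) (rule C(4))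
  \<comment> \<open>the errors decrease like \<open>4^(-n)\<close>, so that they remain summable after scaling by \<open>2^n\<close>\<close>
  have step: "\<exists>y\<in>C n. \<forall>y'\<in>C n. s (z + (1/2)^Suc n *\<^sub>R y) \<le> s (z + (1/2)^Suc n *\<^sub>R y') + \<eta> * (1/4)^Suc n" for z n
  proof -
    let ?g = "\<lambda>y. s (z + (1/2)^Suc n *\<^sub>R y)"
    have bb: "bdd_below (?g ` C n)" by (rule bdd_belowI2[where m=0]) (rule s_nonneg)
    have "(INF y\<in>C n. ?g y) < (INF y\<in>C n. ?g y) + \<eta> * (1/4)^Suc n" using \<eta> by simp
    then obtain y where "y \<in> C n" "?g y < (INF y\<in>C n. ?g y) + \<eta> * (1/4)^Suc n"
      using cINF_less_iff[OF C(3) bb] by blast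
    moreover have "(INF y\<in>C n. ?g y) \<le> ?g y'" if "y' \<in> C n" for y'
      by (rule cINF_lower[OF bb that])
    ultimately show ?thesis by (meson add_right_mono less_imp_le order_trans)
  qed
  define f where "f z n = (SOME y. y \<in> C n \<and> (\<forall>y'\<in>C n. s (z + (1/2)^Suc n *\<^sub>R y) \<le> s (z + (1/2)^Suc n *\<^sub>R y') + \<eta> * (1/4)^Suc n))" for z n
  have f: "f z n \<in> C n" "y' \<in> C n \<Longrightarrow> s (z + (1/2)^Suc n *\<^sub>R f z n) \<le> s (z + (1/2)^Suc n *\<^sub>R y') + \<eta> * (1/4)^Suc n" for z n y'
    using someI_ex[OF step[of n z, unfolded Bex_def]] unfolding f_def by blast+
  define z where "z = rec_nat 0 (\<lambda>n z. z + (1/2)^Suc n *\<^sub>R f z n)"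
  define y where "y n = f (z n) n" for n
  have z0: "z 0 = 0" and zS: "z (Suc n) = z n + (1/2)^Suc n *\<^sub>R y n" for n
    by (auto simp: z_def y_def)
  have yC: "y n \<in> C n" for n unfolding y_def by (rule f)
  have zsum: "z n = (\<Sum>j<n. (1/2)^Suc j *\<^sub>R y j)" for n
    by (induction n) (auto simp: z0 zS)
  have yC': "y (j + n) \<in> C n" for j n using yC[of "j + n"] CC[of n "j + n"] by auto
  have yb: "norm (y n) \<le> M" for n using C_bdd yC CC[of 0 n] by blast
  define w where "w n = (\<Sum>j. (1/2)^Suc j *\<^sub>R y (j + n))" for n
  have wC: "w n \<in> C n" for n
    unfolding w_def
    by (rule dyadic_convex_sum(2)[OF V C(1,2), where B=M]) (use yC' yb in auto)
  have y_sum: "summable (\<lambda>j. (1/2)^Suc j *\<^sub>R y j)"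
    by (rule dyadic_convex_sum(1)[OF V C(1,2)[of 0], where B=M]) (use yC'[where n=0] yb in auto)
  have y_sum': "summable (\<lambda>j. (1/2)^Suc j *\<^sub>R y (j + n))" for n
    by (rule dyadic_convex_sum(1)[OF V C(1,2)[of n], where B=M]) (use yC' yb in auto)
  define u where "u = w 0"
  have uz: "u = z n + (1/2)^n *\<^sub>R w n" for n
  proof -
    have "u = (\<Sum>j. (1/2)^Suc (j + n) *\<^sub>R y (j + n)) + z n"
      unfolding u_def w_def zsum using suminf_split_initial_segment[OF y_sum, of n] by simp
    also have "(\<Sum>j. (1/2)^Suc (j + n) *\<^sub>R y (j + n)) = (\<Sum>j. (1/2)^n *\<^sub>R ((1/2)^Suc j *\<^sub>R y (j + n)))"
      by (simp add: power_add mult_ac)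
    also have "\<dots> = (1/2)^n *\<^sub>R w n"
      unfolding w_def by (rule suminf_scaleR_right[OF y_sum', symmetric])
    finally show ?thesis by simp
  qed
  have gain: "2^n * (s u - s (z n)) \<ge> s u - \<eta> * (1 - (1/2)^n)" for n
  proof (induction n)
    case 0
    have "s 0 \<le> 0" by (rule sle) (use bdd[of _ 0] in simp)
    then show ?case by (simp add: z0)
  next
    case (Suc n)
    \<comment> \<open>with \<open>w n\<close> in place of \<open>y n\<close> the next partial sum is the midpoint of \<open>z n\<close> and \<open>u\<close>\<close>
    have eq: "z n + (1/2)^Suc n *\<^sub>R w n = (1/2) *\<^sub>R (z n + u)"
      unfolding uz[of n] by (simp add: scaleR_add_right flip: scaleR_left.add)
    have "s (z (Suc n)) \<le> s (z n + (1/2)^Suc n *\<^sub>R w n) + \<eta> * (1/4)^Suc n"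
      unfolding zS y_def by (rule f(2)[OF wC])
    also have "\<dots> \<le> (s (z n) + s u) / 2 + \<eta> * (1/4)^Suc n"
      unfolding eq using half by simp
    finally have "(s u - s (z n)) / 2 - \<eta> * (1/4)^Suc n \<le> s u - s (z (Suc n))" by (simp add: field_simps)
    then have "2^Suc n * ((s u - s (z n)) / 2 - \<eta> * (1/4)^Suc n) \<le> 2^Suc n * (s u - s (z (Suc n)))"
      by (intro mult_left_mono) auto
    moreover have "2^Suc n * (1/4)^Suc n = ((1/2)::real)^Suc n"
      by (simp flip: power_mult_distrib)
    then have "2^Suc n * ((s u - s (z n)) / 2 - \<eta> * (1/4)^Suc n) = 2^n * (s u - s (z n)) - \<eta> * (1/2)^Suc n"
      by (simp add: right_diff_distrib)
    moreover have "\<eta> * (1 - (1/2)^n) + \<eta> * (1/2)^Suc n = \<eta> * (1 - (1/2)^Suc n)"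
      by (simp add: field_simps)
    ultimately show ?case using Suc.IH by linarith
  qed
  obtain p where p: "p \<in> S" "\<And>q. q \<in> S \<Longrightarrow> norm (E u q) \<le> norm (E u p)"
    using continuous_attains_sup[OF S ne continuous_on_norm[OF cont]] by blast
  have su: "s u = norm (E u p)"
    using sle[OF p(2)] les[OF p(1)] by (intro antisym)
  have "c \<le> s u" using big wC[of 0] les order_trans unfolding u_def by blast
  have "c' \<le> norm (E (w n) p)" for n
  proof -
    have "E u p = E (z n) p + (1/2)^n *\<^sub>R E (w n) p"
      unfolding uz[of n] linear_add[OF lin[OF p(1)]] linear_scale[OF lin[OF p(1)]] ..
    then have "s u \<le> norm (E (z n) p) + (1/2)^n * norm (E (w n) p)"
      unfolding su by (metis norm_triangle_ineq norm_scaleR abs_of_nonneg zero_le_power zero_le_divide_1_iff zero_le_numeral)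
    then have "s u - s (z n) \<le> (1/2)^n * norm (E (w n) p)" using les[OF p(1), of "z n"] by simp
    then have "2^n * (s u - s (z n)) \<le> norm (E (w n) p)" by (simp add: power_divide field_simps)
    moreover have "\<eta> * (1 - (1/2)^n) \<le> \<eta>" using \<eta> by (simp add: field_simps)
    ultimately show ?thesis using gain[of n] \<open>c \<le> s u\<close> by (simp add: \<eta>_def)
  qed
  then show ?thesis using p(1) wC by blast
qed

section \<open>Bump functions on compact Hausdorff spaces\<close>

lemma apply_bcontfun_sum:
  "apply_bcontfun (\<Sum>j\<in>F. f j) x = (\<Sum>j\<in>F. apply_bcontfun (f j) x)"
  by (induction F rule: infinite_finite_induct) auto

definition bump_between :: "'k::topological_space set \<Rightarrow> 'k set \<Rightarrow> ('k \<Rightarrow>\<^sub>C real) \<Rightarrow> bool" where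
  "bump_between V U \<phi> \<longleftrightarrow> (\<forall>x. 0 \<le> apply_bcontfun \<phi> x \<and> apply_bcontfun \<phi> x \<le> 1) \<and>
     (\<forall>x\<in>V. apply_bcontfun \<phi> x = 1) \<and> (\<forall>x. x \<notin> U \<longrightarrow> apply_bcontfun \<phi> x = 0)"

lemma bump_between_mono: "bump_between V U \<phi> \<Longrightarrow> V' \<subseteq> V \<Longrightarrow> U \<subseteq> U' \<Longrightarrow> bump_between V' U' \<phi>"
  unfolding bump_between_def by blast

lemma bump_exists:
  assumes K: "compact (UNIV :: 'k::t2_space set)" and U: "open U" "k \<in> (U :: 'k::t2_space set)"
  obtains V \<phi> where "open V" "k \<in> V" "V \<subseteq> U" "bump_between V U \<phi>"
proof -
  have "Hausdorff_space (euclidean :: 'k topology)"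
    unfolding Hausdorff_space_def disjnt_def using hausdorff by (metis open_openin)
  then have "normal_space (euclidean :: 'k topology)"
    by (intro compact_Hausdorff_or_regular_imp_normal_space) (use K in \<open>simp_all add: compact_space_def\<close>)
  then obtain f where f: "continuous_map euclidean euclideanreal f" "f ` {k} \<subseteq> {1}" "f ` (- U) \<subseteq> {0}"
    by (rule Urysohn_lemma_alt[of euclidean "{k}" "- U" 1 0]) (use U in \<open>auto simp: disjnt_def\<close>)
  have cf: "continuous_on UNIV f" using f(1) by simp
  define g where "g x = max 0 (min 1 (2 * f x))" for x
  have cg: "continuous_on UNIV g" unfolding g_def by (intro continuous_intros cf)
  have g: "apply_bcontfun (Bcontfun g) = g"
    by (rule Bcontfun_inverse, rule bcontfun_normI[OF cg, of 1]) (auto simp: g_def)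
  show ?thesis
  proof (rule that[of "{x. 1/2 < f x}" "Bcontfun g"])
    show "open {x. 1/2 < f x}" by (rule open_Collect_less[OF continuous_on_const cf])
    show "{x. 1/2 < f x} \<subseteq> U" using f(3) by force
    show "bump_between {x. 1/2 < f x} U (Bcontfun g)"
      unfolding bump_between_def g using f(3) by (auto simp: g_def)
  qed (use f(2) in auto)
qed

text \<open>
The replacement for countable additivity and regularity of the representing vector measure: bumps
that step down a family \<open>\<W>\<close> of sets, each leaving a smaller member of \<open>\<W>\<close> untouched, can be continued
to a sequence with disjoint supports.  Its signed sums are bounded by \<open>1\<close>, so the images cannot stay
away from \<open>0\<close> in a space without \<open>c\<^sub>0\<close>.
\<close>

lemma no_escaping_bumps:
  fixes \<Lambda> :: "('k::topological_space \<Rightarrow>\<^sub>C real) \<Rightarrow> 'y::banach"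
  assumes c0: "\<not> contains_c0 TYPE('y)"
    and lin: "linear \<Lambda>" and bdd: "\<And>\<phi>. norm (\<Lambda> \<phi>) \<le> B * norm \<phi>"
    and \<epsilon>: "0 < \<epsilon>" and ne: "\<W> \<noteq> {}"
    and step: "\<And>W. W \<in> \<W> \<Longrightarrow> \<exists>W'\<in>\<W>. W' \<subseteq> W \<and> (\<exists>\<phi>. (\<forall>x. \<bar>apply_bcontfun \<phi> x\<bar> \<le> 1) \<and>
        (\<forall>x. apply_bcontfun \<phi> x \<noteq> 0 \<longrightarrow> x \<in> W - W') \<and> \<epsilon> \<le> norm (\<Lambda> \<phi>))"
  shows False
proof -
  obtain W0 where W0: "W0 \<in> \<W>" using ne by blast
  obtain next_set bump where step':
    "\<And>W. W \<in> \<W> \<Longrightarrow> next_set W \<in> \<W> \<and> next_set W \<subseteq> W \<and> (\<forall>x. \<bar>apply_bcontfun (bump W) x\<bar> \<le> 1) \<and>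
       (\<forall>x. apply_bcontfun (bump W) x \<noteq> 0 \<longrightarrow> x \<in> W - next_set W) \<and> \<epsilon> \<le> norm (\<Lambda> (bump W))"
    using step by metis
  define W where "W n = (next_set ^^ n) W0" for n
  define \<phi> where "\<phi> n = bump (W n)" for n
  have WW: "W n \<in> \<W>" for n by (induction n) (use W0 step' in \<open>auto simp: W_def\<close>)
  have WS: "W (Suc n) = next_set (W n)" for n by (simp add: W_def)
  have W_anti: "W n \<subseteq> W m" if "m \<le> n" for m n
    using that by (rule lift_Suc_antimono_le[rotated]) (use step'[OF WW] in \<open>auto simp: WS\<close>)
  have \<phi>: "\<bar>apply_bcontfun (\<phi> n) x\<bar> \<le> 1" "apply_bcontfun (\<phi> n) x \<noteq> 0 \<Longrightarrow> x \<in> W n - W (Suc n)"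
    "\<epsilon> \<le> norm (\<Lambda> (\<phi> n))" for n x
    using step'[OF WW] unfolding \<phi>_def WS by blast+
  have disj: "m = n" if "apply_bcontfun (\<phi> m) x \<noteq> 0" "apply_bcontfun (\<phi> n) x \<noteq> 0" for m n x
  proof (rule ccontr)
    assume "m \<noteq> n"
    moreover have False if "i < j" "apply_bcontfun (\<phi> i) x \<noteq> 0" "apply_bcontfun (\<phi> j) x \<noteq> 0" for i j
      using \<phi>(2)[OF that(2)] \<phi>(2)[OF that(3)] W_anti[of "Suc i" j] that(1) by auto
    ultimately show False using that by (metis nat_neq_iff)
  qed
  have "\<exists>n. norm (\<Lambda> (\<phi> n)) < \<epsilon>"
  proof (rule bessaga_pelczynski[OF c0 _ \<epsilon>, of _ "\<bar>B\<bar>"])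
    fix t :: "nat \<Rightarrow> real" and F :: "nat set"
    assume F: "finite F" and t: "\<And>j. \<bar>t j\<bar> \<le> 1"
    let ?s = "\<Sum>j\<in>F. t j *\<^sub>R \<phi> j"
    have "norm (apply_bcontfun ?s x) \<le> 1" for x
    proof (cases "\<exists>i\<in>F. apply_bcontfun (\<phi> i) x \<noteq> 0")
      case True
      then obtain i where i: "i \<in> F" "apply_bcontfun (\<phi> i) x \<noteq> 0" by blast
      have "apply_bcontfun ?s x = (\<Sum>j\<in>F. if j = i then t i * apply_bcontfun (\<phi> i) x else 0)"
        unfolding apply_bcontfun_sum by (rule sum.cong) (use disj[OF _ i(2)] in auto)
      also have "\<dots> = t i * apply_bcontfun (\<phi> i) x" using F i by simp
      finally show ?thesis using t[of i] \<phi>(1)[of i x] by (simp add: abs_mult mult_le_one)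
    next
      case False
      then show ?thesis unfolding apply_bcontfun_sum by simp
    qed
    then have "norm ?s \<le> 1" by (rule norm_bound)
    have "(\<Sum>j\<in>F. t j *\<^sub>R \<Lambda> (\<phi> j)) = \<Lambda> ?s"
      using lin by (simp add: linear_sum linear_scale)
    also have "norm \<dots> \<le> B * norm ?s" by (rule bdd)
    also have "\<dots> \<le> \<bar>B\<bar> * 1" by (rule mult_mono) (use \<open>norm ?s \<le> 1\<close> in auto)
    finally show "norm (\<Sum>j\<in>F. t j *\<^sub>R \<Lambda> (\<phi> j)) \<le> \<bar>B\<bar>" by simp
  qed
  then show False using \<phi>(3) by (meson not_le)
qed

section \<open>Embeddings into continuous vector-valued functions and their atoms\<close>

text \<open>
An isomorphic embedding of \<open>C('k)\<close> into the continuous functions from a compact space \<open>S\<close> to \<open>'y\<close>,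
written pointwise.  For fixed \<open>p\<close> in \<open>S\<close> one may think of \<open>\<lambda>v. E v p\<close> as integration against a
\<open>'y\<close>-valued measure on \<open>'k\<close>.
\<close>

locale norming_system =
  fixes S :: "'p::t2_space set" and E :: "('k::t2_space \<Rightarrow>\<^sub>C real) \<Rightarrow> 'p \<Rightarrow> 'y::banach" and B c :: real
  assumes K: "compact (UNIV :: 'k set)" and S: "compact S"
    and cont: "\<And>v. continuous_on S (E v)"
    and lin: "\<And>p. p \<in> S \<Longrightarrow> linear (\<lambda>v. E v p)"
    and bdd: "\<And>v p. p \<in> S \<Longrightarrow> norm (E v p) \<le> B * norm v"
    and norming: "\<And>v. \<exists>p\<in>S. c * norm v \<le> norm (E v p)"
    and c: "0 < c"
    and c0: "\<not> contains_c0 TYPE('y)"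
begin

text \<open>
Convex combinations of the \<open>\<psi> n\<close> still take the value \<open>1\<close> at \<open>k\<close>, hence have norm \<open>1\<close> and are large
somewhere on \<open>S\<close>; Simons' lemma makes the place independent of \<open>n\<close>.
\<close>

lemma charges_often:
  fixes \<psi> :: "nat \<Rightarrow> 'k \<Rightarrow>\<^sub>C real"
  assumes \<psi>: "\<And>n x. \<bar>apply_bcontfun (\<psi> n) x\<bar> \<le> 1" "\<And>n. apply_bcontfun (\<psi> n) k = 1" and d: "d < c"
  shows "\<exists>p\<in>S. \<exists>\<^sub>\<infinity>n. d \<le> norm (E (\<psi> n) p)"
proof (rule ccontr)
  assume "\<not> ?thesis"
  then have rare: "\<exists>m. \<forall>n\<ge>m. norm (E (\<psi> n) p) < d" if "p \<in> S" for p
    using that unfolding INFM_nat_le by (metis not_le)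
  obtain d' where d': "d < d'" "d' < c" using d dense by blast
  define C where "C n = closure (convex hull (\<psi> ` {n..}))" for n
  have bl: "bounded_linear (\<lambda>v::'k \<Rightarrow>\<^sub>C real. apply_bcontfun v k)"
    by (rule bounded_linear_intro[where K=1]) (auto intro: norm_bounded simp flip: real_norm_def)
  have one: "norm v = 1" if "v \<in> C 0" for v
  proof (rule antisym)
    have "C 0 \<subseteq> cball 0 1" unfolding C_def
      by (intro closure_minimal hull_minimal) (auto intro!: norm_bound \<psi>(1))
    then show "norm v \<le> 1" using that by auto
    let ?H = "(\<lambda>v. apply_bcontfun v k) -` {1}"
    have "C 0 \<subseteq> ?H" unfolding C_def
      by (intro closure_minimal hull_minimal closed_vimage continuous_at_imp_continuous_on ballI
          linear_continuous_at[OF bl] convex_linear_vimage bounded_linear.linear[OF bl])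
        (auto simp: \<psi>(2) linear_continuous_on[OF bl])
    then show "1 \<le> norm v" using that norm_bounded[of v k] by auto
  qed
  have "\<exists>p\<in>S. \<forall>n. \<exists>v\<in>C n. d' \<le> norm (E v p)"
  proof (rule simons_lemma[where E=E and S=S and B=B and M=1 and c=c])
    show "closed (C n)" for n by (simp add: C_def)
    show "convex (C n)" for n by (simp add: C_def convex_closure)
    show "C n \<noteq> {}" for n by (auto simp: C_def)
    show "C (Suc n) \<subseteq> C n" for n unfolding C_def by (intro closure_mono hull_mono image_mono) auto
    show "\<exists>p\<in>S. c \<le> norm (E v p)" if "v \<in> C 0" for v using norming[of v] one[OF that] by simp
  qed (use one d' complete_bcontfun S cont lin bdd in auto)
  then obtain p where p: "p \<in> S" "\<And>n. \<exists>v\<in>C n. d' \<le> norm (E v p)" by blast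
  obtain m where m: "\<And>n. m \<le> n \<Longrightarrow> norm (E (\<psi> n) p) < d" using rare[OF p(1)] by blast
  have bE: "bounded_linear (\<lambda>v. E v p)"
    using bdd[OF p(1)]
    by (intro bounded_linear_intro[where K=B]) (auto simp: linear_add[OF lin[OF p(1)]] linear_scale[OF lin[OF p(1)]] mult.commute)
  have "C m \<subseteq> (\<lambda>v. E v p) -` cball 0 d" unfolding C_def
    by (intro closure_minimal hull_minimal closed_vimage linear_continuous_on[OF bE] convex_linear_vimage
          bounded_linear.linear[OF bE] convex_cball closed_cball)
      (use less_imp_le[OF m] in auto)
  then show False using p(2)[of m] d' by force
qed

text \<open>
This is the statement that the measure at \<open>p\<close> gives \<open>{k}\<close> mass at least \<open>d\<close>, with the mass tested by
bumps around \<open>k\<close>.  The neighbourhood \<open>U\<close> keeps the rest of the measure from cancelling the atom.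
\<close>

definition atom :: "real \<Rightarrow> 'p \<Rightarrow> 'k \<Rightarrow> bool" where
  "atom d p k \<longleftrightarrow> (\<exists>U. open U \<and> k \<in> U \<and>
     (\<forall>V \<phi>. open V \<longrightarrow> k \<in> V \<longrightarrow> bump_between V U \<phi> \<longrightarrow> d \<le> norm (E \<phi> p)))"

text \<open>
For a fixed \<open>U\<close> the set of all \<open>p\<close> with \<open>d \<le> norm (E \<phi> p)\<close> is closed.  So if no \<open>p\<close> has the atom, then by
compactness every \<open>U\<close> contains a smaller neighbourhood \<open>V\<close> such that each \<open>p\<close> has \<^emph>\<open>some\<close> bump
between \<open>V\<close> and \<open>U\<close> of small image.  Iterating gives a decreasing sequence of neighbourhoods.  Bumps \<open>\<psi> n\<close>
between consecutive ones, chosen independently of \<open>p\<close>, have large images at a common point \<open>p\<close>; but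
there they differ from bumps of small image only on the disjoint differences of the neighbourhoods,
which contributes nothing in the limit.  Since \<open>k\<close> need not have a countable neighbourhood base, the
neighbourhoods have to be chosen adaptively in this way.
\<close>

lemma atom_exists:
  assumes d: "d < c"
  shows "\<exists>p\<in>S. atom d p k"
proof (rule ccontr)
  assume no_atom: "\<not> ?thesis"
  have shrink: "\<exists>V. open V \<and> k \<in> V \<and> V \<subseteq> U \<and> (\<forall>p\<in>S. \<exists>\<phi>. bump_between V U \<phi> \<and> norm (E \<phi> p) < d)"
    if U: "open U" "k \<in> U" for U
  proof (rule ccontr)
    assume "\<not> ?thesis"
    then have bad: "\<exists>p\<in>S. \<forall>\<phi>. bump_between V U \<phi> \<longrightarrow> d \<le> norm (E \<phi> p)" if "open V" "k \<in> V" "V \<subseteq> U" for V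
      using that by (metis not_le)
    define \<F> where "\<F> = {\<phi>. \<exists>V. open V \<and> k \<in> V \<and> bump_between V U \<phi>}"
    have "S \<inter> (\<Inter>\<phi>\<in>\<F>. {p\<in>S. d \<le> norm (E \<phi> p)}) \<noteq> {}"
    proof (rule compact_imp_fip_image[OF S])
      show "closed {p\<in>S. d \<le> norm (E \<phi> p)}" for \<phi>
      proof (rule continuous_on_closed_Collect_le)
        show "continuous_on S (\<lambda>p. norm (E \<phi> p))" by (rule continuous_on_norm[OF cont])
        show "closed S" by (rule compact_imp_closed[OF S])
      qed (rule continuous_on_const)
      fix F assume F: "finite F" "F \<subseteq> \<F>"
      have "\<forall>\<phi>\<in>F. \<exists>V. open V \<and> k \<in> V \<and> bump_between V U \<phi>"
        using F(2) unfolding \<F>_def by blast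
      from bchoice[OF this] obtain V where V: "\<And>\<phi>. \<phi> \<in> F \<Longrightarrow> open (V \<phi>) \<and> k \<in> V \<phi> \<and> bump_between (V \<phi>) U \<phi>"
        by blast
      have "\<exists>p\<in>S. \<forall>\<phi>. bump_between (U \<inter> (\<Inter>\<phi>\<in>F. V \<phi>)) U \<phi> \<longrightarrow> d \<le> norm (E \<phi> p)"
        by (rule bad) (use U V F in auto)
      then obtain p where p: "p \<in> S" and p': "\<And>\<phi>. bump_between (U \<inter> (\<Inter>\<phi>\<in>F. V \<phi>)) U \<phi> \<Longrightarrow> d \<le> norm (E \<phi> p)" by blast
      have "bump_between (U \<inter> (\<Inter>\<phi>\<in>F. V \<phi>)) U \<phi>" if "\<phi> \<in> F" for \<phi>
        by (rule bump_between_mono[of "V \<phi>" U]) (use V that in auto)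
      then have "p \<in> S \<inter> (\<Inter>\<phi>\<in>F. {p\<in>S. d \<le> norm (E \<phi> p)})" using p p' by auto
      then show "S \<inter> (\<Inter>\<phi>\<in>F. {p\<in>S. d \<le> norm (E \<phi> p)}) \<noteq> {}" by (metis emptyE)
    qed
    then obtain p where "p \<in> S" "\<And>\<phi>. \<phi> \<in> \<F> \<Longrightarrow> d \<le> norm (E \<phi> p)" by blast
    then have "atom d p k" unfolding atom_def \<F>_def using U by blast
    then show False using no_atom \<open>p \<in> S\<close> by blast
  qed
  define good where "good U V \<psi> \<longleftrightarrow> open V \<and> k \<in> V \<and> V \<subseteq> U \<and> bump_between V U \<psi> \<and>
      (\<forall>p\<in>S. \<exists>\<phi>. bump_between V U \<phi> \<and> norm (E \<phi> p) < d)" for U V \<psi>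
  have "\<exists>V \<psi>. good U V \<psi>" if U: "open U" "k \<in> U" for U
  proof -
    obtain V where V: "open V" "k \<in> V" "V \<subseteq> U" "\<forall>p\<in>S. \<exists>\<phi>. bump_between V U \<phi> \<and> norm (E \<phi> p) < d"
      using shrink[OF U] by blast
    obtain V' \<psi> where V': "open V'" "k \<in> V'" "V' \<subseteq> V" "bump_between V' V \<psi>"
      using bump_exists[OF K V(1,2)] by metis
    have "bump_between V' U \<psi>" by (rule bump_between_mono[OF V'(4)]) (use V in auto)
    moreover have "\<forall>p\<in>S. \<exists>\<phi>. bump_between V' U \<phi> \<and> norm (E \<phi> p) < d"
      using V(4) bump_between_mono[OF _ V'(3) order_refl] by blast
    ultimately have "good U V' \<psi>" unfolding good_def using V V' by auto
    then show ?thesis by blast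
  qed
  then obtain nx \<Psi> where good: "\<And>U. open U \<Longrightarrow> k \<in> U \<Longrightarrow> good U (nx U) (\<Psi> U)" by metis
  have nx: "open (nx U)" "k \<in> nx U" "nx U \<subseteq> U" "bump_between (nx U) U (\<Psi> U)"
    "\<And>p. p \<in> S \<Longrightarrow> \<exists>\<phi>. bump_between (nx U) U \<phi> \<and> norm (E \<phi> p) < d"
    if U: "open U" "k \<in> U" for U
    using good[OF U] unfolding good_def by auto
  define U where "U n = (nx ^^ n) UNIV" for n
  define \<psi> where "\<psi> n = \<Psi> (U n)" for n
  have US: "U (Suc n) = nx (U n)" for n by (simp add: U_def)
  have Uk: "open (U n) \<and> k \<in> U n" for n by (induction n) (use nx in \<open>auto simp: U_def\<close>)
  have \<psi>: "bump_between (U (Suc n)) (U n) (\<psi> n)" for n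
    using nx(4) Uk unfolding US \<psi>_def by blast
  have Usub: "U (Suc n) \<subseteq> U n" for n using nx(3) Uk unfolding US by blast
  have U_anti: "U n \<subseteq> U m" if "m \<le> n" for m n
    using that by (rule lift_Suc_antimono_le[rotated]) (rule Usub)
  obtain d' where d': "d < d'" "d' < c" using d dense by blast
  have "\<exists>p\<in>S. \<exists>\<^sub>\<infinity>n. d' \<le> norm (E (\<psi> n) p)"
  proof (rule charges_often[OF _ _ d'(2)])
    show "\<bar>apply_bcontfun (\<psi> n) x\<bar> \<le> 1" for n x using \<psi>[of n] by (simp add: bump_between_def)
    show "apply_bcontfun (\<psi> n) k = 1" for n using \<psi>[of n] Uk[of "Suc n"] by (simp add: bump_between_def)
  qed
  then obtain p where p: "p \<in> S" "\<exists>\<^sub>\<infinity>n. d' \<le> norm (E (\<psi> n) p)" by blast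
  have "\<forall>n. \<exists>\<phi>. bump_between (U (Suc n)) (U n) \<phi> \<and> norm (E \<phi> p) < d"
    using nx(5)[OF _ _ p(1)] Uk unfolding US by blast
  then obtain \<phi> where \<phi>: "\<And>n. bump_between (U (Suc n)) (U n) (\<phi> n)" "\<And>n. norm (E (\<phi> n) p) < d"
    by metis
  show False
  proof (rule no_escaping_bumps[OF c0 lin[OF p(1)] bdd[OF p(1)], of "d' - d" "range U"])
    fix W assume "W \<in> range U"
    then obtain n where W: "W = U n" by blast
    obtain m where m: "n \<le> m" "d' \<le> norm (E (\<psi> m) p)" using p(2) unfolding INFM_nat_le by blast
    have "d' - d \<le> norm (E (\<psi> m - \<phi> m) p)"
      using m(2) \<phi>(2)[of m] norm_triangle_ineq2[of "E (\<psi> m) p" "E (\<phi> m) p"] linear_diff[OF lin[OF p(1)]] by simp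
    moreover have "\<bar>apply_bcontfun (\<psi> m - \<phi> m) x\<bar> \<le> 1" for x
      using \<psi>[of m] \<phi>(1)[of m] by (simp add: bump_between_def abs_le_iff) (smt (verit))
    moreover have "x \<in> W - U (Suc m)" if "apply_bcontfun (\<psi> m - \<phi> m) x \<noteq> 0" for x
    proof -
      have "apply_bcontfun (\<psi> m) x \<noteq> apply_bcontfun (\<phi> m) x" using that by simp
      then have "x \<in> U m" "x \<notin> U (Suc m)"
        using \<psi>[of m] \<phi>(1)[of m] unfolding bump_between_def by metis+
      then show ?thesis using U_anti[OF m(1)] W by blast
    qed
    moreover have "U (Suc m) \<subseteq> W" using U_anti[of n "Suc m"] m(1) W by simp
    ultimately show "\<exists>W'\<in>range U. W' \<subseteq> W \<and> (\<exists>\<phi>. (\<forall>x. \<bar>apply_bcontfun \<phi> x\<bar> \<le> 1) \<and>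
        (\<forall>x. apply_bcontfun \<phi> x \<noteq> 0 \<longrightarrow> x \<in> W - W') \<and> d' - d \<le> norm (E \<phi> p))"
      by blast
  qed (use d' in auto)
qed

text \<open>
Bumps around infinitely many atoms would step down the neighbourhoods of an accumulation point.
\<close>

lemma finite_atoms:
  assumes p: "p \<in> S" and d: "0 < d"
  shows "finite {k. atom d p k}"
proof (rule ccontr)
  assume "infinite {k. atom d p k}"
  then obtain x where x: "x islimpt {k. atom d p k}"
    using Heine_Borel_imp_Bolzano_Weierstrass[OF K] by blast
  show False
  proof (rule no_escaping_bumps[OF c0 lin[OF p] bdd[OF p] d, of "{W. open W \<and> x \<in> W}"])
    fix W assume "W \<in> {W. open W \<and> x \<in> W}"
    then have W: "open W" "x \<in> W" by auto
    obtain k where k: "atom d p k" "k \<in> W" "k \<noteq> x" using islimptE[OF x W(2,1)] by blast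
    obtain O1 O2 where O: "open O1" "open O2" "k \<in> O1" "x \<in> O2" "O1 \<inter> O2 = {}"
      using hausdorff[OF k(3)] by blast
    obtain U where U: "open U" "k \<in> U" "\<And>V \<phi>. open V \<Longrightarrow> k \<in> V \<Longrightarrow> bump_between V U \<phi> \<Longrightarrow> d \<le> norm (E \<phi> p)"
      using k(1) unfolding atom_def by blast
    obtain V \<phi> where V: "open V" "k \<in> V" "bump_between V (U \<inter> O1 \<inter> W) \<phi>"
      using bump_exists[OF K, of "U \<inter> O1 \<inter> W" k] U O W k by (metis IntI open_Int)
    have "d \<le> norm (E \<phi> p)" by (rule U(3)[OF V(1,2)]) (rule bump_between_mono[OF V(3)], auto)
    moreover have "\<bar>apply_bcontfun \<phi> y\<bar> \<le> 1" "apply_bcontfun \<phi> y \<noteq> 0 \<Longrightarrow> y \<in> W - W \<inter> O2" for y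
      using V(3) O(5) unfolding bump_between_def by auto
    ultimately show "\<exists>W'\<in>{W. open W \<and> x \<in> W}. W' \<subseteq> W \<and> (\<exists>\<phi>. (\<forall>x. \<bar>apply_bcontfun \<phi> x\<bar> \<le> 1) \<and>
        (\<forall>x. apply_bcontfun \<phi> x \<noteq> 0 \<longrightarrow> x \<in> W - W') \<and> d \<le> norm (E \<phi> p))"
      using W O by (intro bexI[of _ "W \<inter> O2"]) auto
  qed auto
qed

lemma lepoll_parameters:
  assumes "infinite S"
  shows "(UNIV :: 'k set) \<lesssim> S"
proof -
  have c2: "0 < c / 2" "c / 2 < c" using c by auto
  have "(UNIV :: 'k set) = (\<Union>p\<in>S. {k. atom (c/2) p k})"
    using atom_exists[OF c2(2)] by blast
  moreover have "(card_of (\<Union>p\<in>S. {k. atom (c/2) p k}), card_of S) \<in> ordLeq"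
  proof (rule card_of_UNION_ordLeq_infinite[OF assms])
    show "(card_of S, card_of S) \<in> ordLeq" by (rule card_of_mono1) simp
    show "\<forall>p\<in>S. (card_of {k. atom (c/2) p k}, card_of S) \<in> ordLeq"
      using finite_atoms[OF _ c2(1)] assms finite_lepoll_infinite
      unfolding card_of_ordLeq[symmetric] lepoll_def by blast
  qed
  ultimately have "(card_of (UNIV :: 'k set), card_of S) \<in> ordLeq" by simp
  then show ?thesis unfolding lepoll_def using card_of_ordLeq[of "UNIV :: 'k set" S] by blast
qed

end

section \<open>Cantor schemes and scattered spaces\<close>

text \<open>
A compact metrizable scattered space is countable; the lemma says this for the metrizable quotient of
\<open>'l\<close> defined by the functions \<open>h i\<close>, without forming the quotient.  Consider the union \<open>G\<close> of the open sets
with countable image.  An isolated point \<open>p\<close> of the complement has a closed neighbourhood \<open>N\<close> inside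
\<open>insert p G\<close>, and what \<open>h\<close> separates from \<open>p\<close> in \<open>N\<close> is a countable union of compact subsets of \<open>G\<close>.
\<close>

lemma countable_image_if_scattered:
  fixes h :: "'i::countable \<Rightarrow> 'l::t2_space \<Rightarrow> real"
  assumes L: "compact (UNIV :: 'l set)" and sc: "scattered_space TYPE('l)"
    and cont: "\<And>i. continuous_on UNIV (h i)"
  shows "countable (range (\<lambda>l i. h i l))"
proof -
  define \<theta> where "\<theta> l = (\<lambda>i. h i l)" for l
  define G where "G = \<Union>{W. open W \<and> countable (\<theta> ` W)}"
  have compact_part: "countable (\<theta> ` M)" if M: "compact M" "M \<subseteq> G" for M
  proof -
    obtain \<C> where "\<C> \<subseteq> {W. open W \<and> countable (\<theta> ` W)}" "finite \<C>" "M \<subseteq> \<Union>\<C>"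
      using compactE[OF M(1), of "{W. open W \<and> countable (\<theta> ` W)}"] M(2) unfolding G_def by blast
    then have "countable (\<Union>W\<in>\<C>. \<theta> ` W)" by (intro countable_UN[OF countable_finite]) auto
    moreover have "\<theta> ` M \<subseteq> (\<Union>W\<in>\<C>. \<theta> ` W)" using \<open>M \<subseteq> \<Union>\<C>\<close> by blast
    ultimately show ?thesis using countable_subset by blast
  qed
  have "G = UNIV"
  proof (rule ccontr)
    assume "G \<noteq> UNIV"
    then have "- G \<noteq> {}" by blast
    then obtain p where "p isolated_in (- G)" using sc unfolding scattered_space_def by blast
    then obtain T where T: "open T" "T \<inter> (- G) = {p}" "p \<notin> G" unfolding isolated_in_def by blast
    have "p \<in> T" using T(2) by blast
    obtain V \<phi> where V: "open V" "p \<in> V" "bump_between V T \<phi>"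
      using bump_exists[OF L T(1) \<open>p \<in> T\<close>] by metis
    define N where "N = {x. 1/2 \<le> apply_bcontfun \<phi> x}"
    have N: "closed N" unfolding N_def by (intro closed_Collect_le continuous_on_const continuous_on_apply_bcontfun)
    have "V \<subseteq> N" using V(3) by (auto simp: N_def bump_between_def)
    have "N \<subseteq> T" using V(3) by (force simp: N_def bump_between_def)
    define M where "M i m = N \<inter> {x. 1 / real (Suc m) \<le> \<bar>h i x - h i p\<bar>}" for i m
    have "countable (\<theta> ` M i m)" for i m
    proof (rule compact_part)
      have "closed {x. 1 / real (Suc m) \<le> \<bar>h i x - h i p\<bar>}"
        by (intro closed_Collect_le continuous_intros cont)
      then have "closed (M i m)" unfolding M_def using N by (rule closed_Int[rotated])
      then show "compact (M i m)" using compact_Int_closed[OF L] by simp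
      have "p \<notin> M i m" by (simp add: M_def)
      show "M i m \<subseteq> G"
      proof
        fix x assume x: "x \<in> M i m"
        then have "x \<in> T" "x \<noteq> p" using \<open>N \<subseteq> T\<close> \<open>p \<notin> M i m\<close> by (auto simp: M_def)
        then show "x \<in> G" using T(2) by blast
      qed
    qed
    moreover have "\<theta> ` V \<subseteq> insert (\<theta> p) (\<Union>i. \<Union>m. \<theta> ` M i m)"
    proof
      fix y assume "y \<in> \<theta> ` V"
      then obtain x where x: "x \<in> V" "y = \<theta> x" by blast
      show "y \<in> insert (\<theta> p) (\<Union>i. \<Union>m. \<theta> ` M i m)"
      proof (cases "y = \<theta> p")
        case False
        then obtain i where "h i x \<noteq> h i p" using x(2) by (auto simp: \<theta>_def)
        then have "0 < \<bar>h i x - h i p\<bar>" by simp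
        then obtain m where "1 / real (Suc m) < \<bar>h i x - h i p\<bar>" using nat_approx_posE by metis
        then have "x \<in> M i m" using x(1) \<open>V \<subseteq> N\<close> by (auto simp: M_def)
        then show ?thesis using x(2) by blast
      qed simp
    qed
    moreover have "countable (insert (\<theta> p) (\<Union>i. \<Union>m. \<theta> ` M i m))"
      by (intro countable_insert countable_UN countableI_type) (rule calculation(1))
    ultimately have "countable (\<theta> ` V)" using countable_subset by blast
    then have "p \<in> G" using V unfolding G_def by blast
    then show False using T(3) by blast
  qed
  then have "countable (\<theta> ` UNIV)" using compact_part[OF L] by simp
  then show ?thesis unfolding \<theta>_def by simp
qed

text \<open>
Words are read with the newest letter first.  The supports form a binary tree, and each bump is \<open>1\<close> on the
supports of its two successors, so that all bumps along a branch share a point where they are \<open>1\<close>.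
\<close>

lemma cantor_scheme:
  assumes K: "compact (UNIV :: 'k::t2_space set)" and A: "A \<noteq> {}" "\<And>x. \<not> x isolated_in (A :: 'k set)"
  obtains \<phi> :: "bool list \<Rightarrow> ('k::t2_space \<Rightarrow>\<^sub>C real)"
  where "\<And>s x. 0 \<le> apply_bcontfun (\<phi> s) x" "\<And>s x. apply_bcontfun (\<phi> s) x \<le> 1"
    "\<And>b s x. apply_bcontfun (\<phi> (b # s)) x \<noteq> 0 \<Longrightarrow> apply_bcontfun (\<phi> s) x = 1"
    "\<And>s x. apply_bcontfun (\<phi> (True # s)) x = 0 \<or> apply_bcontfun (\<phi> (False # s)) x = 0"
    "\<And>s. \<exists>x. apply_bcontfun (\<phi> s) x = 1"
proof -
  define split where "split U V \<psi> \<longleftrightarrow> (\<forall>b. open (V b) \<and> V b \<inter> A \<noteq> {} \<and> bump_between (V b) U (\<psi> b)) \<and>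
      (\<forall>x. apply_bcontfun (\<psi> True) x = 0 \<or> apply_bcontfun (\<psi> False) x = 0)"
    for U and V :: "bool \<Rightarrow> 'k set" and \<psi>
  have "\<exists>V \<psi>. split U V \<psi>" if U: "open U" "U \<inter> A \<noteq> {}" for U
  proof -
    obtain a where a: "a \<in> U" "a \<in> A" using U(2) by blast
    then have "U \<inter> A \<noteq> {a}" using A(2)[of a] U(1) unfolding isolated_in_def by blast
    then obtain b where b: "b \<in> U" "b \<in> A" "b \<noteq> a" using a by blast
    obtain Oa Ob where O: "open Oa" "open Ob" "a \<in> Oa" "b \<in> Ob" "Oa \<inter> Ob = {}"
      using hausdorff[OF b(3)[symmetric]] by blast
    obtain Va \<psi>a where Va: "open Va" "a \<in> Va" "bump_between Va (U \<inter> Oa) \<psi>a"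
      using bump_exists[OF K, of "U \<inter> Oa" a] U O a by (metis IntI open_Int)
    obtain Vb \<psi>b where Vb: "open Vb" "b \<in> Vb" "bump_between Vb (U \<inter> Ob) \<psi>b"
      using bump_exists[OF K, of "U \<inter> Ob" b] U O b by (metis IntI open_Int)
    have "split U (\<lambda>i. if i then Va else Vb) (\<lambda>i. if i then \<psi>a else \<psi>b)"
      unfolding split_def
    proof (intro conjI allI)
      show "apply_bcontfun (if True then \<psi>a else \<psi>b) x = 0 \<or> apply_bcontfun (if False then \<psi>a else \<psi>b) x = 0" for x
        using Va(3) Vb(3) O(5) unfolding bump_between_def by (cases "x \<in> Oa") auto
    qed (use Va Vb a b in \<open>auto intro: bump_between_mono\<close>)
    then show ?thesis by blast
  qed
  then obtain V \<Psi> where split: "\<And>U. open U \<Longrightarrow> U \<inter> A \<noteq> {} \<Longrightarrow> split U (V U) (\<Psi> U)" by metis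
  define W where "W s = foldr (\<lambda>b U. V U b) s UNIV" for s
  define \<phi> where "\<phi> s = (case s of [] \<Rightarrow> const_bcontfun 1 | b # s' \<Rightarrow> \<Psi> (W s') b)" for s
  have W: "open (W s) \<and> W s \<inter> A \<noteq> {}" for s
    by (induction s) (use split A(1) in \<open>auto simp: W_def split_def\<close>)
  have sp: "split (W s) (\<lambda>b. W (b # s)) (\<lambda>b. \<phi> (b # s))" for s
    using split[of "W s"] W[of s] by (simp add: W_def \<phi>_def)
  have one: "x \<in> W s \<Longrightarrow> apply_bcontfun (\<phi> s) x = 1" for s x
    by (cases s) (use sp in \<open>auto simp: split_def bump_between_def \<phi>_def const_bcontfun.rep_eq\<close>)
  have bounds: "0 \<le> apply_bcontfun (\<phi> s) x \<and> apply_bcontfun (\<phi> s) x \<le> 1" for s x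
  proof (cases s)
    case (Cons b s')
    then show ?thesis using sp[of s'] unfolding split_def bump_between_def by blast
  qed (simp add: \<phi>_def const_bcontfun.rep_eq)
  show ?thesis
  proof (rule that[of \<phi>])
    show "apply_bcontfun (\<phi> s) x = 1" if "apply_bcontfun (\<phi> (b # s)) x \<noteq> 0" for b s x
      using sp[of s] that one unfolding split_def bump_between_def by blast
    show "apply_bcontfun (\<phi> (True # s)) x = 0 \<or> apply_bcontfun (\<phi> (False # s)) x = 0" for s x
      using sp[of s] unfolding split_def by blast
    show "\<exists>x. apply_bcontfun (\<phi> s) x = 1" for s using one W[of s] by blast
  qed (use bounds in auto)
qed

definition branch :: "(nat \<Rightarrow> bool) \<Rightarrow> nat \<Rightarrow> bool list" where
  "branch \<sigma> n = rev (map \<sigma> [0..<n])"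

lemma branch_simps [simp]: "branch \<sigma> 0 = []" "branch \<sigma> (Suc n) = \<sigma> n # branch \<sigma> n" "length (branch \<sigma> n) = n"
  by (auto simp: branch_def)

lemma branch_split: "n \<le> m \<Longrightarrow> \<exists>u. branch \<sigma> m = u @ branch \<sigma> n"
proof (induction rule: dec_induct)
  case base then show ?case by (metis append_Nil)
next
  case (step m) then show ?case by (metis append_Cons branch_simps(2))
qed

lemma branch_eqD: "branch \<sigma> m = branch \<tau> m \<Longrightarrow> i < m \<Longrightarrow> \<sigma> i = \<tau> i"
  by (induction m) (auto simp: less_Suc_eq)

context norming_system
begin

text \<open>
If \<open>'k\<close> were not scattered, there would be a Cantor scheme of bumps in it.  Every branch \<open>\<sigma>\<close> is detected
by a point \<open>p\<close> of \<open>S\<close> in the sense of \<open>R\<close>, and every \<open>p\<close> detects only countably many branches.  What \<open>p\<close>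
detects depends only on the countably many numbers \<open>norm (E (\<phi> s) p)\<close>, so if
countably many functions on \<open>S\<close> always have countable joint image, then there are only countably many
branches altogether, contradicting Cantor's theorem.
\<close>

lemma scattered_domain:
  assumes param: "\<And>h :: bool list \<Rightarrow> 'p \<Rightarrow> real. (\<And>s. continuous_on S (h s)) \<Longrightarrow> countable ((\<lambda>p s. h s p) ` S)"
  shows "scattered_space TYPE('k)"
proof (rule ccontr)
  assume "\<not> ?thesis"
  then obtain A :: "'k set" where A: "A \<noteq> {}" "\<And>x. \<not> x isolated_in A" unfolding scattered_space_def by blast
  obtain \<phi> :: "bool list \<Rightarrow> 'k \<Rightarrow>\<^sub>C real" where
    \<phi>_bounds: "\<And>s x. 0 \<le> apply_bcontfun (\<phi> s) x" "\<And>s x. apply_bcontfun (\<phi> s) x \<le> 1"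
    and \<phi>_nest: "\<And>b s x. apply_bcontfun (\<phi> (b # s)) x \<noteq> 0 \<Longrightarrow> apply_bcontfun (\<phi> s) x = 1"
    and \<phi>_split: "\<And>s x. apply_bcontfun (\<phi> (True # s)) x = 0 \<or> apply_bcontfun (\<phi> (False # s)) x = 0"
    and \<phi>_peak: "\<And>s. \<exists>x. apply_bcontfun (\<phi> s) x = 1"
    using cantor_scheme[OF K A] by blast
  have abs1: "\<bar>apply_bcontfun (\<phi> s) x\<bar> \<le> 1" for s x using \<phi>_bounds[of s x] by simp
  define N where "N s = {x. apply_bcontfun (\<phi> s) x \<noteq> 0}" for s
  have N_append: "N (u @ s) \<subseteq> N s" for u s
    by (induction u) (use \<phi>_nest in \<open>force simp: N_def\<close>)+
  have N_disj: "s = t" if "length s = length t" "x \<in> N s" "x \<in> N t" for s t x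
    using that
  proof (induction s t rule: list_induct2)
    case (Cons b s c t)
    have "x \<in> N s" "x \<in> N t" using N_append[of "[b]" s] N_append[of "[c]" t] Cons.prems by auto
    then have "s = t" by (rule Cons.IH)
    moreover have "b = c" using \<phi>_split[of s x] Cons.prems \<open>s = t\<close> by (cases b; cases c) (auto simp: N_def)
    ultimately show ?case by simp
  qed simp
  define d where "d = c / 2"
  have d: "0 < d" "d < c" using c by (auto simp: d_def)
  define D where "D p = {s. d \<le> norm (E (\<phi> s) p)}" for p
  define R where "R p = {\<sigma>. \<exists>\<^sub>\<infinity>n. branch \<sigma> n \<in> D p}" for p
  have cover: "\<exists>p\<in>S. \<sigma> \<in> R p" for \<sigma>
  proof -
    define Q where "Q n = {x. apply_bcontfun (\<phi> (branch \<sigma> n)) x = 1}" for n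
    have Q_anti: "Q n \<subseteq> Q m" if "m \<le> n" for m n
    proof (rule lift_Suc_antimono_le[of Q, OF _ that])
      show "Q (Suc n) \<subseteq> Q n" for n using \<phi>_nest[of "\<sigma> n" "branch \<sigma> n"] by (auto simp: Q_def)
    qed
    have "UNIV \<inter> (\<Inter>n\<in>UNIV. Q n) \<noteq> {}"
    proof (rule compact_imp_fip_image[OF K])
      show "closed (Q n)" for n unfolding Q_def
        by (intro closed_Collect_eq continuous_on_const continuous_on_apply_bcontfun)
      fix I :: "nat set" assume I: "finite I"
      obtain x where "x \<in> Q (Max I)" using \<phi>_peak by (auto simp: Q_def)
      then have "x \<in> UNIV \<inter> (\<Inter>n\<in>I. Q n)" using Q_anti Max_ge[OF I] by blast
      then show "UNIV \<inter> (\<Inter>n\<in>I. Q n) \<noteq> {}" by blast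
    qed
    then obtain k where "\<And>n. apply_bcontfun (\<phi> (branch \<sigma> n)) k = 1" unfolding Q_def by blast
    then show ?thesis
      using charges_often[of "\<lambda>n. \<phi> (branch \<sigma> n)" k d] abs1 d(2) unfolding R_def D_def by simp
  qed
  have R_countable: "countable (R p)" if p: "p \<in> S" for p
  proof -
    \<comment> \<open>nodes in \<open>D p\<close> leaving \<open>\<sigma>\<close> arbitrarily late would carry bumps stepping down the supports along \<open>\<sigma>\<close>;
      so beyond some node of \<open>\<sigma>\<close> all of \<open>D p\<close> lies on \<open>\<sigma>\<close>, and this node determines \<open>\<sigma>\<close>\<close>
    have "\<exists>n. \<forall>t\<in>D p. (\<exists>u. t = u @ branch \<sigma> n) \<longrightarrow> t = branch \<sigma> (length t)" for \<sigma>
    proof (rule ccontr)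
      assume "\<not> ?thesis"
      then have off: "\<exists>t\<in>D p. (\<exists>u. t = u @ branch \<sigma> n) \<and> t \<noteq> branch \<sigma> (length t)" for n by blast
      show False
      proof (rule no_escaping_bumps[OF c0 lin[OF p] bdd[OF p] d(1), of "range (\<lambda>n. N (branch \<sigma> n))"])
        fix W assume "W \<in> range (\<lambda>n. N (branch \<sigma> n))"
        then obtain n where W: "W = N (branch \<sigma> n)" by blast
        obtain t u where t: "t \<in> D p" "t = u @ branch \<sigma> n" "t \<noteq> branch \<sigma> (length t)" using off by blast
        define W' where "W' = N (branch \<sigma> (length t))"
        obtain v where "branch \<sigma> (length t) = v @ branch \<sigma> n"
          using branch_split[of n "length t" \<sigma>] t(2) by auto
        then have "W' \<subseteq> W" unfolding W W'_def using N_append[of v] by simp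
        moreover have "x \<in> W - W'" if "apply_bcontfun (\<phi> t) x \<noteq> 0" for x
        proof -
          have x: "x \<in> N t" using that by (simp add: N_def)
          then have "x \<in> W" using N_append[of u "branch \<sigma> n"] t(2) W by auto
          moreover have "x \<notin> W'" using N_disj[of t "branch \<sigma> (length t)" x] x t(3) by (auto simp: W'_def)
          ultimately show ?thesis by blast
        qed
        ultimately show "\<exists>W'\<in>range (\<lambda>n. N (branch \<sigma> n)). W' \<subseteq> W \<and> (\<exists>\<phi>. (\<forall>x. \<bar>apply_bcontfun \<phi> x\<bar> \<le> 1) \<and>
            (\<forall>x. apply_bcontfun \<phi> x \<noteq> 0 \<longrightarrow> x \<in> W - W') \<and> d \<le> norm (E \<phi> p))"
          using abs1 t(1) unfolding D_def W'_def by blast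
      qed auto
    qed
    then obtain n where n: "\<And>\<sigma> t. t \<in> D p \<Longrightarrow> (\<exists>u. t = u @ branch \<sigma> (n \<sigma>)) \<Longrightarrow> t = branch \<sigma> (length t)"
      by metis
    have "inj_on (\<lambda>\<sigma>. branch \<sigma> (n \<sigma>)) (R p)"
    proof (rule inj_onI, rule ext)
      fix \<sigma> \<tau> i assume st: "\<sigma> \<in> R p" "\<tau> \<in> R p" "branch \<sigma> (n \<sigma>) = branch \<tau> (n \<tau>)"
      obtain m where m: "max (Suc i) (n \<tau>) \<le> m" "branch \<tau> m \<in> D p"
        using st(2) unfolding R_def INFM_nat_le by blast
      have "branch \<tau> m = branch \<sigma> m"
        using n[OF m(2), of \<sigma>] branch_split[of "n \<tau>" m \<tau>] m(1) st(3) by auto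
      then show "\<sigma> i = \<tau> i" using branch_eqD[of \<sigma> m \<tau> i] m(1) by auto
    qed
    then show ?thesis by (rule countableI')
  qed
  define \<theta> where "\<theta> p = (\<lambda>s. norm (E (\<phi> s) p))" for p
  have \<theta>: "countable (\<theta> ` S)"
    unfolding \<theta>_def by (rule param) (rule continuous_on_norm[OF cont])
  define R' where "R' f = {\<sigma>. \<exists>\<^sub>\<infinity>n. d \<le> f (branch \<sigma> n)}" for f :: "bool list \<Rightarrow> real"
  have R': "R p = R' (\<theta> p)" for p by (simp add: R_def R'_def D_def \<theta>_def)
  have "countable (\<Union>f\<in>\<theta> ` S. R' f)"
    by (rule countable_UN[OF \<theta>]) (use R_countable R' in auto)
  moreover have "(\<Union>f\<in>\<theta> ` S. R' f) = UNIV" using cover R' by blast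
  ultimately have "countable (UNIV :: (nat \<Rightarrow> bool) set)" by simp
  then obtain f :: "nat \<Rightarrow> nat \<Rightarrow> bool" where "range f = UNIV" using range_from_nat_into by blast
  then obtain n where "f n = (\<lambda>i. \<not> f i i)" by (metis rangeE UNIV_I)
  then show False by (metis (full_types))
qed

end

section \<open>Complemented \<open>c\<^sub>0\<close>-sums in \<open>\<ell>\<^sub>\<infinity>\<close>-sums\<close>

text \<open>
A form of Phillips' lemma.  The staircase condition \<open>tail\<close> makes \<open>\<Sum>k. t k *\<^sub>R v k\<close> converge
coordinatewise for every bounded \<open>t\<close>, which defines an operator \<open>comb\<close> from \<open>\<ell>\<^sub>\<infinity>\<close> although the series
does not converge in norm.  Rosenthal's lemma yields an infinite \<open>Q\<close> such that \<open>\<Lambda> n\<close>, for \<open>n\<close> in \<open>Q\<close>,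
hardly notices \<open>comb\<close> of coefficients supported in \<open>Q - {n}\<close>; so \<open>\<Lambda> n\<close> stays near \<open>1\<close> at the single vector
\<open>comb (indicator Q)\<close>, contradicting \<open>null\<close>.
\<close>

lemma no_null_functionals_normed_on_staircase:
  fixes v :: "nat \<Rightarrow> nat \<Rightarrow>\<^sub>C 'w::real_normed_vector" and \<Lambda> :: "nat \<Rightarrow> (nat \<Rightarrow>\<^sub>C 'w) \<Rightarrow> real"
  assumes W: "complete (UNIV :: 'w set)"
    and bound: "\<And>t F. finite F \<Longrightarrow> (\<And>j. \<bar>t j\<bar> \<le> 1) \<Longrightarrow> norm (\<Sum>j\<in>F. t j *\<^sub>R v j) \<le> C"
    and tail: "\<And>i k. i < k \<Longrightarrow> norm (apply_bcontfun (v k) i) \<le> (1/2)^k"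
    and lin: "\<And>k. linear (\<Lambda> k)" and bdd: "\<And>k w. \<bar>\<Lambda> k w\<bar> \<le> M * norm w"
    and null: "\<And>w. (\<lambda>k. \<Lambda> k w) \<longlonglongrightarrow> 0"
    and one: "\<And>k. \<Lambda> k (v k) = 1"
  shows False
proof -
  define T where "T = {t :: nat \<Rightarrow> real. \<exists>B\<ge>0. \<forall>j. \<bar>t j\<bar> \<le> B}"
  define comb where "comb t = Bcontfun (\<lambda>i. \<Sum>k. t k *\<^sub>R apply_bcontfun (v k) i)" for t
  have summ: "summable (\<lambda>k. t k *\<^sub>R apply_bcontfun (v k) i)" if "t \<in> T" for t i
  proof -
    obtain B where B: "0 \<le> B" "\<And>j. \<bar>t j\<bar> \<le> B" using \<open>t \<in> T\<close> by (auto simp: T_def)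
    show ?thesis
    proof (rule summable_if_complete[OF W])
      show "summable (\<lambda>k. B * (1/2)^k)" by (simp add: summable_mult summable_geometric)
      show "norm (t k *\<^sub>R apply_bcontfun (v k) i) \<le> B * (1/2)^k" if "Suc i \<le> k" for k
        using mult_mono[OF B(2) tail[of i k] B(1)] that by simp
    qed
  qed
  have le: "norm (\<Sum>k. t k *\<^sub>R apply_bcontfun (v k) i) \<le> C * B" if "0 \<le> B" "\<And>j. \<bar>t j\<bar> \<le> B" for t i B
  proof -
    have tT: "t \<in> T" using that by (auto simp: T_def)
    have "norm (\<Sum>k<n. t k *\<^sub>R apply_bcontfun (v k) i) \<le> C * B" for n
    proof -
      have "(\<Sum>k<n. t k *\<^sub>R apply_bcontfun (v k) i) = apply_bcontfun (\<Sum>k<n. t k *\<^sub>R v k) i"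
        by (simp add: apply_bcontfun_sum)
      also have "norm \<dots> \<le> norm (\<Sum>k<n. t k *\<^sub>R v k)" by (rule norm_bounded)
      also have "\<dots> \<le> C * B" by (rule finite_sums_scaled[OF bound]) (use that in auto)
      finally show ?thesis .
    qed
    then show ?thesis using Lim_bounded[OF tendsto_norm[OF summable_LIMSEQ[OF summ[OF tT]]], of 0] by blast
  qed
  have comb: "apply_bcontfun (comb t) i = (\<Sum>k. t k *\<^sub>R apply_bcontfun (v k) i)" if "t \<in> T" for t i
  proof -
    obtain B where B: "0 \<le> B" "\<And>j. \<bar>t j\<bar> \<le> B" using \<open>t \<in> T\<close> by (auto simp: T_def)
    have "(\<lambda>i. \<Sum>k. t k *\<^sub>R apply_bcontfun (v k) i) \<in> bcontfun"
      by (rule bcontfun_normI[where b="C * B"]) (use le[OF B] in auto)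
    then show ?thesis unfolding comb_def by (simp add: Bcontfun_inverse)
  qed
  have T_add: "(\<lambda>j. s j + t j) \<in> T" if "s \<in> T" "t \<in> T" for s t
  proof -
    obtain B B' where "0 \<le> B" "\<And>j. \<bar>s j\<bar> \<le> B" "0 \<le> B'" "\<And>j. \<bar>t j\<bar> \<le> B'"
      using \<open>s \<in> T\<close> \<open>t \<in> T\<close> unfolding T_def by blast
    then show ?thesis unfolding T_def mem_Collect_eq
      by (intro exI[of _ "B + B'"] conjI allI) (auto intro: order_trans[OF abs_triangle_ineq] add_mono)
  qed
  have comb_add: "comb (\<lambda>j. s j + t j) = comb s + comb t" if "s \<in> T" "t \<in> T" for s t
    by (rule bcontfun_eqI)
      (simp add: comb T_add that scaleR_add_left suminf_add[OF summ summ])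
  have comb_norm: "norm (comb t) \<le> C" if "\<And>j. \<bar>t j\<bar> \<le> 1" for t
  proof (rule norm_bound)
    have "t \<in> T" using that by (auto simp: T_def intro: exI[of _ 1])
    then show "norm (apply_bcontfun (comb t) i) \<le> C" for i using le[of 1 t i] that by (simp add: comb)
  qed
  obtain Q where Q: "infinite Q"
    "\<And>n t. n \<in> Q \<Longrightarrow> t \<in> T \<Longrightarrow> (\<And>j. \<bar>t j\<bar> \<le> 1) \<Longrightarrow> (\<And>j. t j \<noteq> 0 \<Longrightarrow> j \<in> Q - {n}) \<Longrightarrow> \<Lambda> n (comb t) \<le> 1/2"
  proof (rule rosenthal_functionals[of T "\<lambda>n t. \<Lambda> n (comb t)" "\<bar>M\<bar> * C" "1/2"])
    show "(\<lambda>_. 0) \<in> T" by (auto simp: T_def)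
    fix n and t :: "nat \<Rightarrow> real" assume t: "\<And>j. \<bar>t j\<bar> \<le> 1"
    have "\<Lambda> n (comb t) \<le> \<bar>M\<bar> * norm (comb t)"
      using bdd[of n "comb t"] mult_right_mono[OF abs_ge_self norm_ge_zero, of M "comb t"] by linarith
    also have "\<dots> \<le> \<bar>M\<bar> * C" by (rule mult_left_mono[OF comb_norm[OF t]]) simp
    finally show "\<Lambda> n (comb t) \<le> \<bar>M\<bar> * C" .
  qed (use T_add comb_add linear_add[OF lin] in auto)
  define u where "u = comb (indicator Q)"
  have TQ: "(\<lambda>j. c * indicator A j) \<in> T" for A c
    by (auto simp: T_def indicator_def intro!: exI[of _ "\<bar>c\<bar>"])
  have "1/2 \<le> \<Lambda> n u" if n: "n \<in> Q" for n
  proof -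
    let ?t = "\<lambda>j. (-1) * indicator (Q - {n}) j :: real"
    have "\<Lambda> n (comb ?t) \<le> 1/2" by (rule Q(2)[OF n TQ]) (auto simp: indicator_def split: if_splits)
    moreover have "comb (\<lambda>j. indicator Q j + ?t j) = u + comb ?t"
      unfolding u_def using TQ[of 1 Q] by (intro comb_add TQ) simp
    moreover have "(\<lambda>j. indicator Q j + ?t j) = (\<lambda>j. 1 * indicator {n} j)"
      using n by (auto simp: indicator_def)
    moreover have "comb (\<lambda>j. 1 * indicator {n} j) = v n"
    proof (rule bcontfun_eqI)
      fix i
      have "(\<Sum>k. (1 * indicator {n} k) *\<^sub>R apply_bcontfun (v k) i)
          = (\<Sum>k\<in>{n}. (1 * indicator {n} k) *\<^sub>R apply_bcontfun (v k) i)"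
        by (rule suminf_finite) auto
      then show "apply_bcontfun (comb (\<lambda>j. 1 * indicator {n} j)) i = apply_bcontfun (v n) i"
        by (subst comb[OF TQ]) simp
    qed
    ultimately have "u + comb ?t = v n" by simp
    then have "\<Lambda> n u + \<Lambda> n (comb ?t) = 1" using one[of n] linear_add[OF lin] by metis
    then show ?thesis using \<open>\<Lambda> n (comb ?t) \<le> 1/2\<close> by simp
  qed
  moreover obtain m where "\<And>k. m \<le> k \<Longrightarrow> \<bar>\<Lambda> k u\<bar> < 1/2"
    using LIMSEQ_D[OF null[of u], of "1/2"] by auto
  moreover obtain n where "n \<in> Q" "m \<le> n" using Q(1) infinite_nat_iff_unbounded_le by blast
  ultimately show False by (smt (verit))
qed

definition single_seq :: "nat \<Rightarrow> 'z::real_normed_vector \<Rightarrow> (nat \<Rightarrow>\<^sub>C 'z)" where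
  "single_seq k z = Bcontfun (\<lambda>i. if i = k then z else 0)"

lemma apply_single_seq [simp]: "apply_bcontfun (single_seq k z) i = (if i = k then z else 0)"
proof -
  have "(\<lambda>i. if i = k then z else 0) \<in> bcontfun" by (rule bcontfun_normI[where b="norm z"]) auto
  then show ?thesis by (simp add: single_seq_def Bcontfun_inverse)
qed

lemma single_seq_add: "single_seq k (x + y) = single_seq k x + single_seq k y"
  and single_seq_scale: "single_seq k (c *\<^sub>R x) = c *\<^sub>R single_seq k x"
  by (rule bcontfun_eqI, simp)+

lemma norm_single_seq [simp]: "norm (single_seq k z) = norm z"
proof (rule antisym)
  show "norm (single_seq k z) \<le> norm z" by (rule norm_bound) auto
  show "norm z \<le> norm (single_seq k z)" using norm_bounded[of "single_seq k z" k] by simp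
qed

lemma single_seq_in_c0: "single_seq k z \<in> c0_space"
  unfolding c0_space_def mem_Collect_eq
  by (rule tendsto_eventually, rule eventually_sequentiallyI[of "Suc k"]) auto

lemma norm_sum_single_seq:
  assumes F: "finite F" and e: "\<And>j. norm (e j) \<le> 1" and t: "\<And>j. \<bar>t j\<bar> \<le> 1"
  shows "norm (\<Sum>j\<in>F. t j *\<^sub>R single_seq j (e j)) \<le> 1"
proof (rule norm_bound)
  fix i
  have "apply_bcontfun (\<Sum>j\<in>F. t j *\<^sub>R single_seq j (e j)) i = (\<Sum>j\<in>F. if i = j then t j *\<^sub>R e j else 0)"
    using F by (induction F) auto
  also have "\<dots> = (if i \<in> F then t i *\<^sub>R e i else 0)" using F by simp
  finally show "norm (apply_bcontfun (\<Sum>j\<in>F. t j *\<^sub>R single_seq j (e j)) i) \<le> 1"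
    using e[of i] t[of i] by (simp add: mult_le_one)
qed

lemma linear_on_sum:
  fixes f :: "'a::real_vector \<Rightarrow> 'b::real_vector"
  assumes S: "subspace S" and add: "\<And>x y. x \<in> S \<Longrightarrow> y \<in> S \<Longrightarrow> f (x + y) = f x + f y"
    and scale: "\<And>c x. x \<in> S \<Longrightarrow> f (c *\<^sub>R x) = c *\<^sub>R f x" and x: "\<And>j. x j \<in> S"
  shows "f (\<Sum>j\<in>F. t j *\<^sub>R x j) = (\<Sum>j\<in>F. t j *\<^sub>R f (x j))"
proof (induction F rule: infinite_finite_induct)
  case (insert i F)
  then show ?case using x by (simp add: add scale subspace_scale[OF S] subspace_sum[OF S])
qed (use scale[OF subspace_0[OF S], of 0] in simp_all)

text \<open>
If \<open>c\<^sub>0('z)\<close> is complemented in \<open>\<ell>\<^sub>\<infinity>('w)\<close>, then some summand \<open>'z\<close> is embedded already by finitely many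
coordinates, that is, into a finite power of \<open>'w\<close>.  Otherwise unit vectors of the \<open>k\<close>-th summand with
negligible first \<open>k\<close> coordinates would form a staircase, on which the coordinates of the projection \<open>P\<close>
are null but norming.
\<close>

lemma complemented_c0_sum_fixes_coordinates:
  fixes A :: "(nat \<Rightarrow>\<^sub>C 'z::real_normed_vector) \<Rightarrow> (nat \<Rightarrow>\<^sub>C 'w::real_normed_vector)"
    and P :: "(nat \<Rightarrow>\<^sub>C 'w) \<Rightarrow> (nat \<Rightarrow>\<^sub>C 'z)"
  assumes W: "complete (UNIV :: 'w set)"
    and A_add: "\<And>a b. a \<in> c0_space \<Longrightarrow> b \<in> c0_space \<Longrightarrow> A (a + b) = A a + A b"
    and A_scale: "\<And>c a. a \<in> c0_space \<Longrightarrow> A (c *\<^sub>R a) = c *\<^sub>R A a"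
    and A_bdd: "\<And>a. a \<in> c0_space \<Longrightarrow> norm (A a) \<le> C * norm a"
    and P_lin: "linear P" and P_bdd: "\<And>w. norm (P w) \<le> M * norm w" and P_c0: "\<And>w. P w \<in> c0_space"
    and PA: "\<And>a. a \<in> c0_space \<Longrightarrow> P (A a) = a"
  shows "\<exists>k. \<forall>z. z \<noteq> 0 \<longrightarrow> (\<exists>i<k. (1/2)^k * norm z < norm (apply_bcontfun (A (single_seq k z)) i))"
proof (rule ccontr)
  assume "\<not> ?thesis"
  then obtain z where z: "\<And>k. z k \<noteq> 0"
    "\<And>i k. i < k \<Longrightarrow> norm (apply_bcontfun (A (single_seq k (z k))) i) \<le> (1/2)^k * norm (z k)"
    by (metis not_le)
  define e where "e k = (1 / norm (z k)) *\<^sub>R z k" for k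
  have e: "norm (e k) = 1" for k using z(1) by (simp add: e_def)
  define v where "v k = A (single_seq k (e k))" for k
  have "\<forall>k. \<exists>f. bounded_linear f \<and> f (e k) = norm (e k) \<and> (\<forall>x. \<bar>f x\<bar> \<le> norm x)"
    using norming_functional by blast
  then obtain \<zeta> where \<zeta>: "\<And>k. bounded_linear (\<zeta> k)" "\<And>k. \<zeta> k (e k) = 1" "\<And>k x. \<bar>\<zeta> k x\<bar> \<le> norm x"
    unfolding e by metis
  define \<Lambda> where "\<Lambda> k w = \<zeta> k (apply_bcontfun (P w) k)" for k w
  have C: "norm (A a) \<le> \<bar>C\<bar>" if "a \<in> c0_space" "norm a \<le> 1" for a
  proof -
    have "norm (A a) \<le> C * norm a" by (rule A_bdd[OF that(1)])
    also have "\<dots> \<le> \<bar>C\<bar> * 1" by (rule mult_mono) (use that in auto)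
    finally show ?thesis by simp
  qed
  show False
  proof (rule no_null_functionals_normed_on_staircase[OF W])
    show "norm (\<Sum>j\<in>F. t j *\<^sub>R v j) \<le> \<bar>C\<bar>" if "finite F" "\<And>j. \<bar>t j\<bar> \<le> 1" for t F
    proof -
      have "(\<Sum>j\<in>F. t j *\<^sub>R v j) = A (\<Sum>j\<in>F. t j *\<^sub>R single_seq j (e j))"
        unfolding v_def by (rule linear_on_sum[symmetric, OF subspace_c0_space A_add A_scale single_seq_in_c0])
      moreover have "norm (A (\<Sum>j\<in>F. t j *\<^sub>R single_seq j (e j))) \<le> \<bar>C\<bar>"
        using that e by (intro C norm_sum_single_seq subspace_sum subspace_scale subspace_c0_space single_seq_in_c0) auto
      ultimately show ?thesis by simp
    qed
    show "norm (apply_bcontfun (v k) i) \<le> (1/2)^k" if "i < k" for i k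
      using z(2)[OF that] z(1)[of k]
      by (simp add: v_def e_def single_seq_scale A_scale single_seq_in_c0 field_simps)
    show "linear (\<Lambda> k)" for k
      unfolding \<Lambda>_def using P_lin bounded_linear.linear[OF \<zeta>(1)]
      by (intro linearI) (simp_all add: linear_add linear_scale)
    show "\<bar>\<Lambda> k w\<bar> \<le> M * norm w" for k w
      unfolding \<Lambda>_def using \<zeta>(3) norm_bounded P_bdd by (meson order_trans)
    show "(\<lambda>k. \<Lambda> k w) \<longlonglongrightarrow> 0" for w
    proof (rule tendsto_norm_zero_cancel, rule Lim_null_comparison[where g="\<lambda>k. norm (apply_bcontfun (P w) k)"])
      show "\<forall>\<^sub>F k in sequentially. norm (norm (\<Lambda> k w)) \<le> norm (apply_bcontfun (P w) k)"
        using \<zeta>(3) by (simp add: \<Lambda>_def)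
      show "(\<lambda>k. norm (apply_bcontfun (P w) k)) \<longlonglongrightarrow> 0"
        using P_c0[of w] by (intro tendsto_norm_zero) (simp add: c0_space_def)
    qed
    show "\<Lambda> k (v k) = 1" for k
      using PA[OF single_seq_in_c0, of k "e k"] \<zeta>(2) by (simp add: \<Lambda>_def v_def)
  qed
qed

section \<open>Transfer of cardinality and scatteredness\<close>

text \<open>
The images in \<open>C('l)\<close> of the unit vectors have bounded signed sums, so they tend to \<open>0\<close> at every point.
Over a finite space they would tend to \<open>0\<close> in norm.
\<close>

lemma infinite_if_isomorphic_c0_sum:
  assumes "isomorphic_spaces (UNIV :: ('l::topological_space \<Rightarrow>\<^sub>C real) set)
     (c0_space :: (nat \<Rightarrow>\<^sub>C ('l \<Rightarrow>\<^sub>C real)) set)"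
  shows "infinite (UNIV :: 'l set)"
proof
  assume fin: "finite (UNIV :: 'l set)"
  obtain f :: "('l \<Rightarrow>\<^sub>C real) \<Rightarrow> (nat \<Rightarrow>\<^sub>C ('l \<Rightarrow>\<^sub>C real))" and g C where
    fg: "\<And>y. y \<in> c0_space \<Longrightarrow> f (g y) = y"
    and g_add: "\<And>y y'. y \<in> c0_space \<Longrightarrow> y' \<in> c0_space \<Longrightarrow> g (y + y') = g y + g y'"
    and g_scale: "\<And>c y. y \<in> c0_space \<Longrightarrow> g (c *\<^sub>R y) = c *\<^sub>R g y"
    and C: "0 < C" "\<And>x. norm (f x) \<le> C * norm x" "\<And>y. y \<in> c0_space \<Longrightarrow> norm (g y) \<le> C * norm y"
    by (rule isomorphic_spacesE[OF assms], rule that, simp_all)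
  define e where "e = (const_bcontfun 1 :: 'l \<Rightarrow>\<^sub>C real)"
  have e: "norm e = 1"
  proof (rule antisym)
    show "norm e \<le> 1" by (rule norm_bound) (simp add: e_def const_bcontfun.rep_eq)
    show "1 \<le> norm e" using norm_bounded[of e undefined] by (simp add: e_def const_bcontfun.rep_eq)
  qed
  define u where "u k = g (single_seq k e)" for k
  have big: "1 / C \<le> norm (u k)" for k
    using C(2)[of "u k"] C(1) e by (simp add: u_def fg single_seq_in_c0 field_simps)
  have "(\<lambda>k. apply_bcontfun (u k) x) \<longlonglongrightarrow> 0" for x
  proof -
    define t where "t k = sgn (apply_bcontfun (u k) x)" for k
    have "(\<Sum>k<n. \<bar>apply_bcontfun (u k) x\<bar>) \<le> C" for n
    proof -
      have "(\<Sum>k<n. \<bar>apply_bcontfun (u k) x\<bar>) = (\<Sum>k<n. t k * apply_bcontfun (u k) x)"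
        by (rule sum.cong) (auto simp: t_def sgn_if)
      also have "\<dots> = apply_bcontfun (\<Sum>k<n. t k *\<^sub>R u k) x" by (simp add: apply_bcontfun_sum)
      also have "(\<Sum>k<n. t k *\<^sub>R u k) = g (\<Sum>k<n. t k *\<^sub>R single_seq k e)"
        unfolding u_def by (rule linear_on_sum[symmetric, OF subspace_c0_space g_add g_scale single_seq_in_c0])
      also have "apply_bcontfun \<dots> x \<le> norm (g (\<Sum>k<n. t k *\<^sub>R single_seq k e))"
        using norm_bounded[of "g (\<Sum>k<n. t k *\<^sub>R single_seq k e)" x] by simp
      also have "\<dots> \<le> C * norm (\<Sum>k<n. t k *\<^sub>R single_seq k e)"
        by (intro C(3) subspace_sum subspace_scale subspace_c0_space single_seq_in_c0)
      also have "\<dots> \<le> C * 1"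
        using C(1) e by (intro mult_left_mono norm_sum_single_seq) (auto simp: t_def sgn_if)
      finally show ?thesis by simp
    qed
    then have "summable (\<lambda>k. \<bar>apply_bcontfun (u k) x\<bar>)"
      by (intro summableI_nonneg_bounded) auto
    then have "(\<lambda>k. \<bar>apply_bcontfun (u k) x\<bar>) \<longlonglongrightarrow> 0" by (rule summable_LIMSEQ_zero)
    then show ?thesis by (rule tendsto_rabs_zero_cancel)
  qed
  then have "\<forall>\<^sub>F k in sequentially. norm (apply_bcontfun (u k) x) < 1 / (2 * C)" for x
    using order_tendstoD(2)[OF tendsto_norm_zero, of "\<lambda>k. apply_bcontfun (u k) x" sequentially "1 / (2 * C)"] C(1) by auto
  then have "\<forall>\<^sub>F k in sequentially. \<forall>x\<in>UNIV. norm (apply_bcontfun (u k) x) < 1 / (2 * C)"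
    using fin by (intro eventually_ball_finite) auto
  then obtain k where "\<And>x. norm (apply_bcontfun (u k) x) < 1 / (2 * C)"
    using eventually_happens'[OF sequentially_bot] by blast
  then have "norm (u k) \<le> 1 / (2 * C)" by (intro norm_bound less_imp_le)
  then show False using big[of k] C(1) by (simp add: field_simps)
qed

lemma continuous_on_discrete_index:
  fixes w :: "nat \<Rightarrow>\<^sub>C ('l::topological_space \<Rightarrow>\<^sub>C 'y::metric_space)"
  shows "continuous_on S (\<lambda>p. apply_bcontfun (apply_bcontfun w (fst p)) (snd p))"
proof -
  have "continuous_on (\<Union>i\<in>UNIV. {i} \<times> UNIV) (\<lambda>p. apply_bcontfun (apply_bcontfun w (fst p)) (snd p))"
  proof (rule continuous_on_open_UN)
    fix i :: nat
    show "open ({i} \<times> (UNIV :: 'l set))" by (intro open_Times open_discrete open_UNIV)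
    have "continuous_on ({i} \<times> UNIV) (\<lambda>p. apply_bcontfun (apply_bcontfun w i) (snd p))"
      by (rule continuous_on_compose2[OF continuous_on_apply_bcontfun[of UNIV] continuous_on_snd[OF continuous_on_id]]) simp
    then show "continuous_on ({i} \<times> UNIV) (\<lambda>p. apply_bcontfun (apply_bcontfun w (fst p)) (snd p))"
      by (rule continuous_on_eq) auto
  qed
  then show ?thesis by (rule continuous_on_subset) auto
qed

text \<open>
Tensoring with a vector \<open>x1\<close> of norm \<open>1\<close> and applying a functional \<open>\<xi>\<close> with \<open>\<xi> x1 = 1\<close> makes \<open>C('k)\<close>
complemented in \<open>\<ell>\<^sub>\<infinity>(C('k, 'x))\<close>, hence \<open>c\<^sub>0(C('k))\<close> complemented in \<open>\<ell>\<^sub>\<infinity>(C('l, 'y))\<close>.  So \<open>C('k)\<close> embeds into a finite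
power of \<open>C('l, 'y)\<close>, which is the space of continuous \<open>'y\<close>-valued functions on \<open>{..<n} \<times> 'l\<close>.
\<close>

lemma cardinality_and_scatteredness_transfer:
  fixes x0 :: "'x::banach"
  assumes x0: "x0 \<noteq> 0" and c0: "\<not> contains_c0 TYPE('y::banach)"
    and K: "compact (UNIV :: 'k::t2_space set)" and L: "compact (UNIV :: 'l::t2_space set)"
    and L_inf: "infinite (UNIV :: 'l set)"
    and CK: "isomorphic_spaces (UNIV :: ('k \<Rightarrow>\<^sub>C real) set) (c0_space :: (nat \<Rightarrow>\<^sub>C ('k \<Rightarrow>\<^sub>C real)) set)"
    and iso: "isomorphic_spaces (UNIV :: (nat \<Rightarrow>\<^sub>C ('k \<Rightarrow>\<^sub>C 'x)) set) (UNIV :: (nat \<Rightarrow>\<^sub>C ('l \<Rightarrow>\<^sub>C 'y)) set)"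
  shows "(UNIV :: 'k set) \<lesssim> (UNIV :: 'l set)"
    and "scattered_space TYPE('l) \<Longrightarrow> scattered_space TYPE('k)"
proof -
  obtain jf :: "('k \<Rightarrow>\<^sub>C real) \<Rightarrow> (nat \<Rightarrow>\<^sub>C ('k \<Rightarrow>\<^sub>C real))" and jg C where
    jf_c0: "\<And>x. jf x \<in> c0_space" and jfg: "\<And>y. y \<in> c0_space \<Longrightarrow> jf (jg y) = y"
    and jf_add: "\<And>x x'. jf (x + x') = jf x + jf x'" and jf_scale: "\<And>c x. jf (c *\<^sub>R x) = c *\<^sub>R jf x"
    and jg_add: "\<And>y y'. y \<in> c0_space \<Longrightarrow> y' \<in> c0_space \<Longrightarrow> jg (y + y') = jg y + jg y'"
    and jg_scale: "\<And>c y. y \<in> c0_space \<Longrightarrow> jg (c *\<^sub>R y) = c *\<^sub>R jg y"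
    and C: "0 < C" "\<And>x. norm (jf x) \<le> C * norm x" "\<And>y. y \<in> c0_space \<Longrightarrow> norm (jg y) \<le> C * norm y"
    by (rule isomorphic_spacesE[OF CK], rule that, simp_all)
  obtain Tf :: "(nat \<Rightarrow>\<^sub>C ('k \<Rightarrow>\<^sub>C 'x)) \<Rightarrow> (nat \<Rightarrow>\<^sub>C ('l \<Rightarrow>\<^sub>C 'y))" and Tg D where
    Tgf: "\<And>x. Tg (Tf x) = x"
    and Tf_add: "\<And>x x'. Tf (x + x') = Tf x + Tf x'" and Tf_scale: "\<And>c x. Tf (c *\<^sub>R x) = c *\<^sub>R Tf x"
    and Tg_add: "\<And>y y'. Tg (y + y') = Tg y + Tg y'" and Tg_scale: "\<And>c y. Tg (c *\<^sub>R y) = c *\<^sub>R Tg y"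
    and D: "0 < D" "\<And>x. norm (Tf x) \<le> D * norm x" "\<And>y. norm (Tg y) \<le> D * norm y"
    by (rule isomorphic_spacesE[OF iso], rule that, simp_all)
  define x1 where "x1 = (1 / norm x0) *\<^sub>R x0"
  have x1: "norm x1 = 1" using x0 by (simp add: x1_def)
  obtain \<xi> where \<xi>: "bounded_linear \<xi>" "\<xi> x1 = 1" "\<And>x. \<bar>\<xi> x\<bar> \<le> norm x"
    using norming_functional[of x1] x1 by auto
  define tens where "tens \<phi> = Bcontfun (\<lambda>k. apply_bcontfun \<phi> k *\<^sub>R x1)" for \<phi> :: "'k \<Rightarrow>\<^sub>C real"
  have tens: "apply_bcontfun (tens \<phi>) k = apply_bcontfun \<phi> k *\<^sub>R x1" for \<phi> k
  proof -
    have "(\<lambda>k. apply_bcontfun \<phi> k *\<^sub>R x1) \<in> bcontfun"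
      by (rule bcontfun_normI[where b="norm \<phi>"])
        (use norm_bounded[of \<phi>] in \<open>auto intro!: continuous_intros simp: x1\<close>)
    then show ?thesis by (simp add: tens_def Bcontfun_inverse)
  qed
  define emb where "emb \<phi> = (const_bcontfun (tens \<phi>) :: nat \<Rightarrow>\<^sub>C ('k \<Rightarrow>\<^sub>C 'x))" for \<phi>
  have emb: "apply_bcontfun (apply_bcontfun (emb \<phi>) i) k = apply_bcontfun \<phi> k *\<^sub>R x1" for \<phi> i k
    by (simp add: emb_def const_bcontfun.rep_eq tens)
  have emb_add: "emb (\<phi> + \<psi>) = emb \<phi> + emb \<psi>" and emb_scale: "emb (c *\<^sub>R \<phi>) = c *\<^sub>R emb \<phi>" for \<phi> \<psi> c
    by (intro bcontfun_eqI, simp add: emb scaleR_add_left)+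
  have emb_norm: "norm (emb \<phi>) \<le> norm \<phi>" for \<phi>
    by (intro norm_bound) (use norm_bounded[of \<phi>] in \<open>simp add: emb x1\<close>)
  define pr where "pr F = Bcontfun (\<lambda>k. \<xi> (apply_bcontfun (apply_bcontfun F 0) k))" for F :: "nat \<Rightarrow>\<^sub>C ('k \<Rightarrow>\<^sub>C 'x)"
  have pr_le: "\<bar>\<xi> (apply_bcontfun (apply_bcontfun F 0) k)\<bar> \<le> norm F" for F :: "nat \<Rightarrow>\<^sub>C ('k \<Rightarrow>\<^sub>C 'x)" and k
    using \<xi>(3) norm_bounded[of "apply_bcontfun F 0" k] norm_bounded[of F 0] by (meson order_trans)
  have pr: "apply_bcontfun (pr F) k = \<xi> (apply_bcontfun (apply_bcontfun F 0) k)" for F k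
  proof -
    have "(\<lambda>k. \<xi> (apply_bcontfun (apply_bcontfun F 0) k)) \<in> bcontfun"
      by (rule bcontfun_normI[where b="norm F"])
        (auto intro!: bounded_linear.continuous_on[OF \<xi>(1)] simp: pr_le)
    then show ?thesis by (simp add: pr_def Bcontfun_inverse)
  qed
  have \<xi>_lin: "linear \<xi>" by (rule bounded_linear.linear[OF \<xi>(1)])
  have pr_add: "pr (F + G) = pr F + pr G" and pr_scale: "pr (c *\<^sub>R F) = c *\<^sub>R pr F" for F G c
    by (rule bcontfun_eqI, simp add: pr linear_add[OF \<xi>_lin] linear_scale[OF \<xi>_lin])+
  have pr_norm: "norm (pr F) \<le> norm F" for F by (rule norm_bound) (simp add: pr pr_le)
  have pr_emb: "pr (emb \<phi>) = \<phi>" for \<phi>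
    by (rule bcontfun_eqI) (simp add: pr emb linear_scale[OF \<xi>_lin] \<xi>(2))
  define A where "A a = Tf (emb (jg a))" for a
  define P where "P w = jf (pr (Tg w))" for w
  have A_add: "A (a + b) = A a + A b" if "a \<in> c0_space" "b \<in> c0_space" for a b
    by (simp add: A_def jg_add that emb_add Tf_add)
  have A_scale: "A (c *\<^sub>R a) = c *\<^sub>R A a" if "a \<in> c0_space" for c a
    by (simp add: A_def jg_scale that emb_scale Tf_scale)
  have A_bdd: "norm (A a) \<le> (D * C) * norm a" if "a \<in> c0_space" for a
  proof -
    have "norm (A a) \<le> D * norm (emb (jg a))" unfolding A_def by (rule D(2))
    also have "\<dots> \<le> D * (C * norm a)"
      using order_trans[OF emb_norm C(3)[OF that]] D(1) by (intro mult_left_mono) auto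
    finally show ?thesis by (simp add: mult.assoc)
  qed
  have "\<exists>k. \<forall>z. z \<noteq> 0 \<longrightarrow> (\<exists>i<k. (1/2)^k * norm z < norm (apply_bcontfun (A (single_seq k z)) i))"
  proof (rule complemented_c0_sum_fixes_coordinates[OF complete_bcontfun A_add A_scale A_bdd])
    show "linear P"
      by (intro linearI) (simp_all add: P_def Tg_add Tg_scale pr_add pr_scale jf_add jf_scale)
    show "norm (P w) \<le> (C * D) * norm w" for w
    proof -
      have "norm (P w) \<le> C * norm (pr (Tg w))" unfolding P_def by (rule C(2))
      also have "\<dots> \<le> C * (D * norm w)"
        using order_trans[OF pr_norm D(3)] C(1) by (intro mult_left_mono) auto
      finally show ?thesis by (simp add: mult.assoc)
    qed
    show "P w \<in> c0_space" for w by (simp add: P_def jf_c0)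
    show "P (A a) = a" if "a \<in> c0_space" for a by (simp add: P_def A_def Tgf pr_emb jfg that)
  qed
  then obtain n where n: "\<And>z. z \<noteq> 0 \<Longrightarrow> \<exists>i<n. (1/2)^n * norm z < norm (apply_bcontfun (A (single_seq n z)) i)" by blast
  define S where "S = {..<n} \<times> (UNIV :: 'l set)"
  define E where "E z p = apply_bcontfun (apply_bcontfun (A (single_seq n z)) (fst p)) (snd p)"
    for z :: "'k \<Rightarrow>\<^sub>C real" and p :: "nat \<times> 'l"
  have "norming_system S E (D * C) ((1/2)^n)"
  proof (rule norming_system.intro)
    show "compact (UNIV :: 'k set)" by (rule K)
    show "compact S" unfolding S_def by (intro compact_Times L finite_imp_compact) simp
    show "continuous_on S (E v)" for v unfolding E_def by (rule continuous_on_discrete_index)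
    show "linear (\<lambda>v. E v p)" if "p \<in> S" for p
      by (intro linearI) (simp_all add: E_def single_seq_add single_seq_scale A_add A_scale single_seq_in_c0)
    show "norm (E v p) \<le> D * C * norm v" for v p
    proof -
      have "norm (E v p) \<le> norm (A (single_seq n v))"
        unfolding E_def by (meson norm_bounded order_trans)
      then show ?thesis using A_bdd[OF single_seq_in_c0, of n v] by simp
    qed
    show "\<exists>p\<in>S. (1/2)^n * norm v \<le> norm (E v p)" for v
    proof (cases "v = 0")
      case True
      have "const_bcontfun 1 \<noteq> (0 :: 'k \<Rightarrow>\<^sub>C real)"
        by (metis const_bcontfun.rep_eq zero_bcontfun.rep_eq zero_neq_one)
      then obtain i where "i < n" using n by blast
      then show ?thesis using True by (intro bexI[of _ "(i, undefined)"]) (auto simp: S_def)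
    next
      case False
      obtain i where i: "i < n" "(1/2)^n * norm v < norm (apply_bcontfun (A (single_seq n v)) i)"
        using n[OF False] by blast
      have "\<exists>l. (1/2)^n * norm v \<le> norm (E v (i, l))"
      proof (rule ccontr)
        assume "\<not> ?thesis"
        then have "norm (apply_bcontfun (apply_bcontfun (A (single_seq n v)) i) l) \<le> (1/2)^n * norm v" for l
          by (simp add: E_def not_le less_imp_le)
        then have "norm (apply_bcontfun (A (single_seq n v)) i) \<le> (1/2)^n * norm v" by (rule norm_bound)
        then show False using i(2) by simp
      qed
      then show ?thesis using i(1) by (auto simp: S_def)
    qed
    show "0 < (1/2 :: real)^n" by simp
    show "\<not> contains_c0 TYPE('y)" by (rule c0)
  qed
  then interpret norming_system S E "D * C" "(1/2)^n" .
  have S_UN: "S = (\<Union>i\<in>{..<n}. {i} \<times> UNIV)" by (auto simp: S_def)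
  have card_S: "(card_of S, card_of (UNIV :: 'l set)) \<in> ordLeq"
    unfolding S_UN
  proof (rule card_of_UNION_ordLeq_infinite[OF L_inf])
    show "(card_of {..<n}, card_of (UNIV :: 'l set)) \<in> ordLeq"
      using finite_lepoll_infinite[OF L_inf, of "{..<n}"] unfolding card_of_ordLeq[symmetric] lepoll_def by blast
    show "\<forall>i\<in>{..<n}. (card_of ({i} \<times> (UNIV :: 'l set)), card_of (UNIV :: 'l set)) \<in> ordLeq"
      unfolding card_of_ordLeq[symmetric] by (intro ballI exI[of _ snd]) (auto simp: inj_on_def)
  qed
  then have S_L: "S \<lesssim> (UNIV :: 'l set)"
    unfolding lepoll_def using card_of_ordLeq[of S "UNIV :: 'l set"] by blast
  show "(UNIV :: 'k set) \<lesssim> (UNIV :: 'l set)"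
  proof (cases "finite S")
    case False
    then show ?thesis using lepoll_parameters S_L lepoll_trans by blast
  next
    case True
    show ?thesis
    proof (cases "n = 0")
      case False
      then show ?thesis using True L_inf by (auto simp: S_def finite_cartesian_product_iff)
    next
      case n0: True
      show ?thesis using norming[of 0] n0 by (simp add: S_def)
    qed
  qed
  show "scattered_space TYPE('k)" if "scattered_space TYPE('l)"
  proof (rule scattered_domain)
    fix h :: "bool list \<Rightarrow> nat \<times> 'l \<Rightarrow> real"
    assume h: "\<And>s. continuous_on S (h s)"
    have "countable (range (\<lambda>l s. h s (i, l)))" if i: "i < n" for i
    proof (rule countable_image_if_scattered[OF L \<open>scattered_space TYPE('l)\<close>])
      show "continuous_on UNIV (\<lambda>l. h s (i, l))" for s
        by (rule continuous_on_compose2[OF h]) (auto intro!: continuous_intros simp: S_def i)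
    qed
    then have "countable (\<Union>i\<in>{..<n}. range (\<lambda>l s. h s (i, l)))" by (intro countable_UN) auto
    moreover have "(\<lambda>p s. h s p) ` S = (\<Union>i\<in>{..<n}. range (\<lambda>l s. h s (i, l)))" by (auto simp: S_def)
    ultimately show "countable ((\<lambda>p s. h s p) ` S)" by simp
  qed
qed

theorem theorem4p4:
  assumes "\<exists>x::'x::banach. x \<noteq> 0"
    and "\<exists>y::'y::banach. y \<noteq> 0"
    and "\<not> contains_c0 TYPE('x)"
    and "\<not> contains_c0 TYPE('y)"
    and "compact (UNIV :: 'k::t2_space set)"
    and "compact (UNIV :: 'l::t2_space set)"
    and "isomorphic_spaces (UNIV :: ('k \<Rightarrow>\<^sub>C real) set)
           (c0_space :: (nat \<Rightarrow>\<^sub>C ('k \<Rightarrow>\<^sub>C real)) set)"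
    and "isomorphic_spaces (UNIV :: ('l \<Rightarrow>\<^sub>C real) set)
           (c0_space :: (nat \<Rightarrow>\<^sub>C ('l \<Rightarrow>\<^sub>C real)) set)"
    and "isomorphic_spaces (UNIV :: (nat \<Rightarrow>\<^sub>C ('k \<Rightarrow>\<^sub>C 'x)) set)
           (UNIV :: (nat \<Rightarrow>\<^sub>C ('l \<Rightarrow>\<^sub>C 'y)) set)"
  shows "(UNIV :: 'k set) \<approx> (UNIV :: 'l set) \<and>
         (scattered_space TYPE('l) \<longleftrightarrow> scattered_space TYPE('k))"
proof -
  obtain x0 :: 'x and y0 :: 'y where x0: "x0 \<noteq> 0" and y0: "y0 \<noteq> 0" using assms(1,2) by blast
  have infK: "infinite (UNIV :: 'k set)" and infL: "infinite (UNIV :: 'l set)"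
    using infinite_if_isomorphic_c0_sum assms(7,8) by blast+
  have iso': "isomorphic_spaces (UNIV :: (nat \<Rightarrow>\<^sub>C ('l \<Rightarrow>\<^sub>C 'y)) set) (UNIV :: (nat \<Rightarrow>\<^sub>C ('k \<Rightarrow>\<^sub>C 'x)) set)"
    by (rule isomorphic_spaces_sym[OF assms(9)])
  note KL = cardinality_and_scatteredness_transfer[OF x0 assms(4,5,6) infL assms(7,9)]
  note LK = cardinality_and_scatteredness_transfer[OF y0 assms(3,6,5) infK assms(8) iso']
  show ?thesis using lepoll_antisym[OF KL(1) LK(1)] KL(2) LK(2) by blast
qed

end
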